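(* Let $u$ be a $C^2$-function on a Gromov manifold $X$ of real dimension $2n$. Consider the section $$\tfrac12\Delta u+i\,\widetilde{\mathbf H}_{\mathrm{skew}}(u)$$ of the complexified Clifford bundle of $X$, acting by Clifford multiplication on the bundle $\mathbf S=\bigoplus_{q=0}^n\Lambda^{0,q}(X)$ of $(0,q)$-forms. Then the Lagrangian Monge-Ampère operator on $X$ is the determinant of this bundle map: $$\mathrm M_{\mathrm{Lag}}(\mathrm{Hess}\,u)=\det\left\{\tfrac12\Delta u+i\,\widetilde{\mathbf H}_{\mathrm{skew}}(u)\right\}.$$
   Context: A Gromov manifold is a triple $(X,\omega,J)$ where $(X,\omega)$ is a symplectic manifold of real dimension $2n$ and $J$ is an almost complex structure with $\omega(v,w)=\omega(Jv,Jw)$ and $\omega(Jv,v)>0$ for all non-zero tangent vectors. It carries the riemannian metric $\langle v,w\rangle=\omega(Jv,w)$; $\mathrm{Hess}\,u$ is the riemannian Hessian $(\mathrm{Hess}\,u)(v,w)=vwu-(\nabla_vw)u$, regarded via the metric as a symmetric endomorphism of $TX$, and $\Delta u=\mathrm{tr}\,\mathrm{Hess}\,u$. For a symmetric endomorphism $A$ of $T_xX$ let $\mu=\frac12\mathrm{tr}A$ and $A^{\mathrm{skew}}=\frac12(A+JAJ)$. Since $A^{\mathrm{skew}}$ anticommutes with $J$, there are a unitary basis $e_1,\dots,e_n$ (so $e_1,Je_1,\dots,e_n,Je_n$ is orthonormal) and $\lambda_j\ge0$ with $A^{\mathrm{skew}}e_j=\lambda_je_j$, $A^{\mathrm{skew}}Je_j=-\lambda_jJe_j$.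 The Lagrangian Monge-Ampère operator is $\mathrm M_{\mathrm{Lag}}(A)=\prod_\pm(\mu\pm\lambda_1\pm\cdots\pm\lambda_n)$, the product over all $2^n$ sign choices. For $A=\mathrm{Hess}_xu$, set $\widetilde{\mathbf H}_{\mathrm{skew}}(u)=\sum_{k=1}^n\lambda_k\,e_k\wedge Je_k\in\Lambda^2T_xX\subset\mathrm{Cl}(T_xX)$, which in the Clifford algebra is $\sum_k\lambda_k\,e_k\cdot Je_k$; it corresponds to the skew endomorphism $\sqrt{(A^{\mathrm{skew}})^2}\,J$ and is independent of the choice of basis. Here $\mathrm{Cl}$ is the Clifford algebra with $v\cdot v=-|v|^2$, and the section lies in $\mathbf{Cl}(X)=\mathrm{Cl}(X)\otimes_{\mathbb R}\mathbb C$, the scalar function $\frac12\Delta u$ meaning $\frac12\Delta u$ times the unit $1$. The bundle $\mathbf S=\bigoplus_q\Lambda^{0,q}(X)\cong\Lambda^*_{\mathbb C}T^*_{\mathbb C}X$, of complex rank $2^n$, is a bundle of irreducible complex $\mathbf{Cl}(X)$-modules, with Clifford multiplication generated by letting a real tangent vector $v$ act by $v\wedge-i_v$ ($i_v$ being contraction), so that $v\cdot v=-|v|^2$. *)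

theory Defs
  imports
    "HOL-Analysis.Analysis"
    "HOL-Algebra.QuotRing"
    "Jordan_Normal_Form.Determinant"
begin

section \<open>Smooth manifolds\<close>

fun Ck_on :: "nat \<Rightarrow> 'e::euclidean_space set \<Rightarrow> ('e \<Rightarrow> 'f::euclidean_space) \<Rightarrow> bool" where
  "Ck_on 0 S f \<longleftrightarrow> continuous_on S f"
| "Ck_on (Suc k) S f \<longleftrightarrow>
     (\<forall>y\<in>S. f differentiable (at y)) \<and> (\<forall>v. Ck_on k S (\<lambda>y. frechet_derivative f (at y) v))"

definition smooth_on :: "'e::euclidean_space set \<Rightarrow> ('e \<Rightarrow> 'f::euclidean_space) \<Rightarrow> bool" where
  "smooth_on S f \<longleftrightarrow> (\<forall>k. Ck_on k S f)"

text \<open>A chart is a pair of a coordinate domain and a coordinate map; the map is only relevant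
  on the domain. The underlying manifold of an atlas is the union of the coordinate domains.\<close>

type_synonym ('a, 'e) chart = "'a set \<times> ('a \<Rightarrow> 'e)"

abbreviation chart_dom :: "('a, 'e) chart \<Rightarrow> 'a set" where
  "chart_dom c \<equiv> fst c"

abbreviation chart_map :: "('a, 'e) chart \<Rightarrow> 'a \<Rightarrow> 'e" where
  "chart_map c \<equiv> snd c"

definition chart_img :: "('a, 'e) chart \<Rightarrow> 'e set" where
  "chart_img c = chart_map c ` chart_dom c"

definition chart_inv :: "('a, 'e) chart \<Rightarrow> 'e \<Rightarrow> 'a" where
  "chart_inv c = inv_into (chart_dom c) (chart_map c)"

definition transition :: "('a, 'e) chart \<Rightarrow> ('a, 'e) chart \<Rightarrow> 'e \<Rightarrow> 'e" where
  "transition c d = chart_map d \<circ> chart_inv c"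

locale smooth_manifold =
  fixes atlas :: "('a::{t2_space,second_countable_topology}, 'e::euclidean_space) chart set"
  assumes chart: "c \<in> atlas \<Longrightarrow>
      open (chart_dom c) \<and> open (chart_img c) \<and>
      homeomorphism (chart_dom c) (chart_img c) (chart_map c) (chart_inv c)"
    and transition_smooth: "c \<in> atlas \<Longrightarrow> d \<in> atlas \<Longrightarrow>
      smooth_on (chart_map c ` (chart_dom c \<inter> chart_dom d)) (transition c d)"

definition Ck_function :: "nat \<Rightarrow> ('a, 'e::euclidean_space) chart set \<Rightarrow> ('a \<Rightarrow> real) \<Rightarrow> bool" where
  "Ck_function k atlas u \<longleftrightarrow> (\<forall>c\<in>atlas. Ck_on k (chart_img c) (u \<circ> chart_inv c))"


section \<open>Gromov manifolds\<close>

text \<open>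
  Each chart \<open>c\<close> around a point \<open>p\<close> identifies the tangent space at \<open>p\<close> with the model
  space \<open>'e\<close>; two charts \<open>c\<close> and \<open>d\<close> give identifications that differ by the derivative of
  the transition map. Accordingly a tensor field is the family of its coordinate expressions:
  \<open>\<omega> c p v w\<close> and \<open>J c p v\<close> are the values at \<open>p\<close> of the tensors on the tangent vectors with
  coordinates \<open>v\<close>, \<open>w\<close> in the chart \<open>c\<close>.
\<close>

locale gromov_manifold = smooth_manifold atlas
  for atlas :: "('a::{t2_space,second_countable_topology}, 'e::euclidean_space) chart set" +
  fixes n :: nat
    and \<omega> :: "('a, 'e) chart \<Rightarrow> 'a \<Rightarrow> 'e \<Rightarrow> 'e \<Rightarrow> real"
    and J :: "('a, 'e) chart \<Rightarrow> 'a \<Rightarrow> 'e \<Rightarrow> 'e"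
  assumes dimension: "DIM('e) = 2 * n"
    and omega_bilinear: "c \<in> atlas \<Longrightarrow> p \<in> chart_dom c \<Longrightarrow> bilinear (\<omega> c p)"
    and omega_alternating: "c \<in> atlas \<Longrightarrow> p \<in> chart_dom c \<Longrightarrow> \<omega> c p v v = 0"
    and omega_smooth: "c \<in> atlas \<Longrightarrow> smooth_on (chart_img c) (\<lambda>y. \<omega> c (chart_inv c y) v w)"
    and omega_transform: "c \<in> atlas \<Longrightarrow> d \<in> atlas \<Longrightarrow> p \<in> chart_dom c \<inter> chart_dom d \<Longrightarrow>
      T = frechet_derivative (transition c d) (at (chart_map c p)) \<Longrightarrow>
      \<omega> c p v w = \<omega> d p (T v) (T w)"
    and omega_nondegenerate: "c \<in> atlas \<Longrightarrow> p \<in> chart_dom c \<Longrightarrow> v \<noteq> 0 \<Longrightarrow> \<exists>w. \<omega> c p v w \<noteq> 0"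
    and omega_closed: "c \<in> atlas \<Longrightarrow> y \<in> chart_img c \<Longrightarrow>
      frechet_derivative (\<lambda>y. \<omega> c (chart_inv c y) v w) (at y) z +
      frechet_derivative (\<lambda>y. \<omega> c (chart_inv c y) w z) (at y) v +
      frechet_derivative (\<lambda>y. \<omega> c (chart_inv c y) z v) (at y) w = 0"
    and J_linear: "c \<in> atlas \<Longrightarrow> p \<in> chart_dom c \<Longrightarrow> linear (J c p)"
    and J_smooth: "c \<in> atlas \<Longrightarrow> smooth_on (chart_img c) (\<lambda>y. J c (chart_inv c y) v)"
    and J_transform: "c \<in> atlas \<Longrightarrow> d \<in> atlas \<Longrightarrow> p \<in> chart_dom c \<inter> chart_dom d \<Longrightarrow>
      T = frechet_derivative (transition c d) (at (chart_map c p)) \<Longrightarrow>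
      T (J c p v) = J d p (T v)"
    and J_square: "c \<in> atlas \<Longrightarrow> p \<in> chart_dom c \<Longrightarrow> J c p (J c p v) = - v"
    and J_invariant: "c \<in> atlas \<Longrightarrow> p \<in> chart_dom c \<Longrightarrow> \<omega> c p v w = \<omega> c p (J c p v) (J c p w)"
    and J_positive: "c \<in> atlas \<Longrightarrow> p \<in> chart_dom c \<Longrightarrow> v \<noteq> 0 \<Longrightarrow> \<omega> c p (J c p v) v > 0"

definition gromov_metric ::
  "(('a, 'e) chart \<Rightarrow> 'a \<Rightarrow> 'e \<Rightarrow> 'e \<Rightarrow> real) \<Rightarrow> (('a, 'e) chart \<Rightarrow> 'a \<Rightarrow> 'e \<Rightarrow> 'e) \<Rightarrow>
   ('a, 'e) chart \<Rightarrow> 'a \<Rightarrow> 'e \<Rightarrow> 'e \<Rightarrow> real" where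
  "gromov_metric \<omega> J c p v w = \<omega> c p (J c p v) w"


section \<open>The riemannian Hessian\<close>

text \<open>Here \<open>G y\<close> is a riemannian metric on an open subset of the model space, and vector fields
  are functions on the model space.\<close>

text \<open>The Koszul formula for constant (hence commuting) vector fields \<open>v\<close>, \<open>w\<close>.\<close>

definition christoffel :: "('e::euclidean_space \<Rightarrow> 'e \<Rightarrow> 'e \<Rightarrow> real) \<Rightarrow> 'e \<Rightarrow> 'e \<Rightarrow> 'e \<Rightarrow> 'e" where
  "christoffel G y v w = (THE z. \<forall>t. 2 * G y z t =
      frechet_derivative (\<lambda>x. G x w t) (at y) v +
      frechet_derivative (\<lambda>x. G x v t) (at y) w -
      frechet_derivative (\<lambda>x. G x v w) (at y) t)"

definition levi_civita ::
  "('e::euclidean_space \<Rightarrow> 'e \<Rightarrow> 'e \<Rightarrow> real) \<Rightarrow> ('e \<Rightarrow> 'e) \<Rightarrow> ('e \<Rightarrow> 'e) \<Rightarrow> 'e \<Rightarrow> 'e" where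
  "levi_civita G V W y = frechet_derivative W (at y) (V y) + christoffel G y (V y) (W y)"

definition vf_deriv :: "('e::euclidean_space \<Rightarrow> 'e) \<Rightarrow> ('e \<Rightarrow> real) \<Rightarrow> 'e \<Rightarrow> real" where
  "vf_deriv V f y = frechet_derivative f (at y) (V y)"

text \<open>\<open>(Hess f)(v,w) = v w f - (\<nabla>\<^sub>v w) f\<close>, with the tangent vectors \<open>v\<close>, \<open>w\<close> extended to
  constant vector fields (the value does not depend on the extensions).\<close>

definition hess_form ::
  "('e::euclidean_space \<Rightarrow> 'e \<Rightarrow> 'e \<Rightarrow> real) \<Rightarrow> ('e \<Rightarrow> real) \<Rightarrow> 'e \<Rightarrow> 'e \<Rightarrow> 'e \<Rightarrow> real" where
  "hess_form G f y v w =
     (let V = (\<lambda>_. v); W = (\<lambda>_. w)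
      in vf_deriv V (vf_deriv W f) y - vf_deriv (levi_civita G V W) f y)"

definition endo_of_form :: "('e \<Rightarrow> 'e \<Rightarrow> real) \<Rightarrow> ('e \<Rightarrow> 'e \<Rightarrow> real) \<Rightarrow> 'e \<Rightarrow> 'e" where
  "endo_of_form g B v = (THE z. \<forall>w. g z w = B v w)"

definition Hess ::
  "(('a, 'e::euclidean_space) chart \<Rightarrow> 'a \<Rightarrow> 'e \<Rightarrow> 'e \<Rightarrow> real) \<Rightarrow>
   (('a, 'e) chart \<Rightarrow> 'a \<Rightarrow> 'e \<Rightarrow> 'e) \<Rightarrow> ('a \<Rightarrow> real) \<Rightarrow> ('a, 'e) chart \<Rightarrow> 'a \<Rightarrow> 'e \<Rightarrow> 'e" where
  "Hess \<omega> J u c p = endo_of_form (gromov_metric \<omega> J c p)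
     (hess_form (\<lambda>y. gromov_metric \<omega> J c (chart_inv c y)) (u \<circ> chart_inv c) (chart_map c p))"

text \<open>The trace does not depend on the basis, so the standard basis of the model space can be used
  although it is not orthonormal for the riemannian metric.\<close>

definition endo_trace :: "('e::euclidean_space \<Rightarrow> 'e) \<Rightarrow> real" where
  "endo_trace A = (\<Sum>b\<in>Basis. inner (A b) b)"

definition Laplacian ::
  "(('a, 'e::euclidean_space) chart \<Rightarrow> 'a \<Rightarrow> 'e \<Rightarrow> 'e \<Rightarrow> real) \<Rightarrow>
   (('a, 'e) chart \<Rightarrow> 'a \<Rightarrow> 'e \<Rightarrow> 'e) \<Rightarrow> ('a \<Rightarrow> real) \<Rightarrow> ('a, 'e) chart \<Rightarrow> 'a \<Rightarrow> real" where
  "Laplacian \<omega> J u c p = endo_trace (Hess \<omega> J u c p)"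


section \<open>The Lagrangian Monge-Ampere operator\<close>

text \<open>From here on, \<open>'e\<close> is a single tangent space with inner product \<open>g\<close> and complex
  structure \<open>J\<close>; the inner product of the class \<open>euclidean_space\<close> plays no role.\<close>

definition skew_part :: "('e::euclidean_space \<Rightarrow> 'e) \<Rightarrow> ('e \<Rightarrow> 'e) \<Rightarrow> 'e \<Rightarrow> 'e" where
  "skew_part J A v = (1/2) *\<^sub>R (A v + J (A (J v)))"

definition unitary_basis ::
  "nat \<Rightarrow> ('e \<Rightarrow> 'e \<Rightarrow> real) \<Rightarrow> ('e \<Rightarrow> 'e) \<Rightarrow> (nat \<Rightarrow> 'e::euclidean_space) \<Rightarrow> bool" where
  "unitary_basis n g J e \<longleftrightarrow>
     (\<forall>j<n. \<forall>k<n. g (e j) (e k) = (if j = k then 1 else 0) \<and>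
        g (J (e j)) (J (e k)) = (if j = k then 1 else 0) \<and> g (e j) (J (e k)) = 0) \<and>
     span (e ` {..<n} \<union> (\<lambda>k. J (e k)) ` {..<n}) = UNIV"

definition skew_frame ::
  "nat \<Rightarrow> ('e \<Rightarrow> 'e \<Rightarrow> real) \<Rightarrow> ('e \<Rightarrow> 'e) \<Rightarrow> ('e \<Rightarrow> 'e) \<Rightarrow>
   (nat \<Rightarrow> 'e::euclidean_space) \<Rightarrow> (nat \<Rightarrow> real) \<Rightarrow> bool" where
  "skew_frame n g J A e l \<longleftrightarrow> unitary_basis n g J e \<and>
     (\<forall>k<n. 0 \<le> l k \<and> skew_part J A (e k) = l k *\<^sub>R e k \<and>
        skew_part J A (J (e k)) = - l k *\<^sub>R J (e k))"

definition M_Lag ::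
  "nat \<Rightarrow> ('e \<Rightarrow> 'e \<Rightarrow> real) \<Rightarrow> ('e \<Rightarrow> 'e) \<Rightarrow> ('e::euclidean_space \<Rightarrow> 'e) \<Rightarrow> real" where
  "M_Lag n g J A = (THE m. \<exists>e l. skew_frame n g J A e l \<and>
     m = (\<Prod>s\<in>{..<n} \<rightarrow>\<^sub>E {-1, 1}. endo_trace A / 2 + (\<Sum>k<n. s k * l k)))"


section \<open>The complexified Clifford algebra\<close>

text \<open>The free associative unital complex algebra on the set \<open>'v\<close>: finitely supported functions on
  words, with concatenation of words as product.\<close>

definition free_alg :: "('v list \<Rightarrow> complex) ring" where
  "free_alg = \<lparr>
     carrier = {f. finite {w. f w \<noteq> 0}},
     mult = (\<lambda>f h w. \<Sum>k\<le>length w. f (take k w) * h (drop k w)),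
     one = (\<lambda>w. if w = [] then 1 else 0),
     zero = (\<lambda>w. 0),
     add = (\<lambda>f h w. f w + h w) \<rparr>"

definition word :: "'v list \<Rightarrow> 'v list \<Rightarrow> complex" where
  "word x = (\<lambda>w. if w = x then 1 else 0)"

text \<open>Imposing real linearity of the generators yields the complexified tensor algebra; the last
  relation is \<open>v \<cdot> v = - g v v\<close>.\<close>

definition clifford_relations ::
  "('v::real_vector \<Rightarrow> 'v \<Rightarrow> real) \<Rightarrow> ('v list \<Rightarrow> complex) set" where
  "clifford_relations g =
     {(\<lambda>x. word [v + w] x - word [v] x - word [w] x) |v w. True} \<union>
     {(\<lambda>x. word [a *\<^sub>R v] x - complex_of_real a * word [v] x) |a v. True} \<union>
     {(\<lambda>x. word [v, v] x + complex_of_real (g v v) * word [] x) |v. True}"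

definition clifford_ideal :: "('v::real_vector \<Rightarrow> 'v \<Rightarrow> real) \<Rightarrow> ('v list \<Rightarrow> complex) set" where
  "clifford_ideal g = genideal free_alg (clifford_relations g)"

definition Cl :: "('v::real_vector \<Rightarrow> 'v \<Rightarrow> real) \<Rightarrow> ('v list \<Rightarrow> complex) set ring" where
  "Cl g = free_alg Quot (clifford_ideal g)"

definition cl_vec :: "('v::real_vector \<Rightarrow> 'v \<Rightarrow> real) \<Rightarrow> 'v \<Rightarrow> ('v list \<Rightarrow> complex) set" where
  "cl_vec g v = clifford_ideal g +>\<^bsub>free_alg\<^esub> word [v]"

definition cl_scal :: "('v::real_vector \<Rightarrow> 'v \<Rightarrow> real) \<Rightarrow> complex \<Rightarrow> ('v list \<Rightarrow> complex) set" where
  "cl_scal g z = clifford_ideal g +>\<^bsub>free_alg\<^esub> (\<lambda>x. z * word [] x)"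

text \<open>The inclusion of the bivectors, \<open>v \<and> w \<mapsto> (v \<cdot> w - w \<cdot> v) / 2\<close>.\<close>

definition cl_wedge :: "('v::real_vector \<Rightarrow> 'v \<Rightarrow> real) \<Rightarrow> 'v \<Rightarrow> 'v \<Rightarrow> ('v list \<Rightarrow> complex) set" where
  "cl_wedge g v w = cl_scal g (1/2) \<otimes>\<^bsub>Cl g\<^esub>
     ((cl_vec g v \<otimes>\<^bsub>Cl g\<^esub> cl_vec g w) \<ominus>\<^bsub>Cl g\<^esub> (cl_vec g w \<otimes>\<^bsub>Cl g\<^esub> cl_vec g v))"

definition H_skew ::
  "nat \<Rightarrow> ('e \<Rightarrow> 'e \<Rightarrow> real) \<Rightarrow> ('e \<Rightarrow> 'e) \<Rightarrow> ('e::euclidean_space \<Rightarrow> 'e) \<Rightarrow>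
   ('e list \<Rightarrow> complex) set" where
  "H_skew n g J A = (THE h. \<exists>e l. skew_frame n g J A e l \<and>
     h = (\<Oplus>\<^bsub>Cl g\<^esub>k\<in>{..<n}. cl_scal g (complex_of_real (l k)) \<otimes>\<^bsub>Cl g\<^esub> cl_wedge g (e k) (J (e k))))"


section \<open>The spinor space of (0,q)-forms\<close>

text \<open>Complex valued forms are functions of the list of their arguments; a \<open>q\<close>-form vanishes on
  lists whose length is not \<open>q\<close>. A form is of type \<open>(0,q)\<close> iff it is conjugate linear in each
  argument with respect to \<open>J\<close>. Forms of different degrees are supported on different lists, so the
  sum in \<open>spinors\<close> is direct.\<close>

definition forms0 :: "('e::real_vector \<Rightarrow> 'e) \<Rightarrow> nat \<Rightarrow> ('e list \<Rightarrow> complex) set" where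
  "forms0 J q = {\<alpha>.
     (\<forall>x. length x \<noteq> q \<longrightarrow> \<alpha> x = 0) \<and>
     (\<forall>x y. length x + length y + 1 = q \<longrightarrow> linear (\<lambda>v. \<alpha> (x @ v # y))) \<and>
     (\<forall>x y z v. \<alpha> (x @ v # y @ v # z) = 0) \<and>
     (\<forall>x y v. \<alpha> (x @ J v # y) = - \<i> * \<alpha> (x @ v # y))}"

definition spinors :: "nat \<Rightarrow> ('e::real_vector \<Rightarrow> 'e) \<Rightarrow> ('e list \<Rightarrow> complex) set" where
  "spinors n J = {(\<lambda>x. \<Sum>q\<le>n. \<alpha> q x) |\<alpha>. \<forall>q\<le>n. \<alpha> q \<in> forms0 J q}"

text \<open>The \<open>(0,1)\<close>-form corresponding to \<open>v\<close> under the \<open>J\<close>-complex linear isomorphism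
  \<open>v \<mapsto> g v - i g (J v) = g v + i g v \<circ> J\<close> of the tangent space with the space of \<open>(0,1)\<close>-forms.
  It is twice the \<open>(0,1)\<close>-part of the real covector \<open>g v\<close>; its value on \<open>v\<close> is \<open>g v v\<close>, which is
  the normalisation that makes the square of \<open>vec_act\<close> equal to \<open>- g v v\<close>.\<close>

definition covector01 :: "('e \<Rightarrow> 'e \<Rightarrow> real) \<Rightarrow> ('e \<Rightarrow> 'e) \<Rightarrow> 'e \<Rightarrow> 'e \<Rightarrow> complex" where
  "covector01 g J v w = complex_of_real (g v w) + \<i> * complex_of_real (g v (J w))"

definition ext_mult :: "('e \<Rightarrow> complex) \<Rightarrow> ('e list \<Rightarrow> complex) \<Rightarrow> 'e list \<Rightarrow> complex" where
  "ext_mult \<theta> s x = (\<Sum>j<length x. (-1) ^ j * \<theta> (x ! j) * s (take j x @ drop (Suc j) x))"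

definition contraction :: "'e \<Rightarrow> ('e list \<Rightarrow> complex) \<Rightarrow> 'e list \<Rightarrow> complex" where
  "contraction v s x = s (v # x)"

definition vec_act ::
  "('e \<Rightarrow> 'e \<Rightarrow> real) \<Rightarrow> ('e \<Rightarrow> 'e) \<Rightarrow> 'e \<Rightarrow> ('e list \<Rightarrow> complex) \<Rightarrow> 'e list \<Rightarrow> complex" where
  "vec_act g J v s x = ext_mult (covector01 g J v) s x - contraction v s x"

definition free_act ::
  "('e \<Rightarrow> 'e \<Rightarrow> real) \<Rightarrow> ('e \<Rightarrow> 'e) \<Rightarrow> ('e list \<Rightarrow> complex) \<Rightarrow>
   ('e list \<Rightarrow> complex) \<Rightarrow> 'e list \<Rightarrow> complex" where
  "free_act g J f s x = (\<Sum>w\<in>{w. f w \<noteq> 0}. f w * foldr (vec_act g J) w s x)"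

text \<open>The Clifford action of a class is that of any of its representatives.\<close>

definition clifford_act ::
  "('e \<Rightarrow> 'e \<Rightarrow> real) \<Rightarrow> ('e \<Rightarrow> 'e) \<Rightarrow> ('e list \<Rightarrow> complex) set \<Rightarrow>
   ('e list \<Rightarrow> complex) \<Rightarrow> 'e list \<Rightarrow> complex" where
  "clifford_act g J X s = (THE t. \<exists>f\<in>X. t = free_act g J f s)"


section \<open>Determinants of endomorphisms of complex function spaces\<close>

definition complex_basis :: "('x \<Rightarrow> complex) set \<Rightarrow> nat \<Rightarrow> (nat \<Rightarrow> 'x \<Rightarrow> complex) \<Rightarrow> bool" where
  "complex_basis S m b \<longleftrightarrow> (\<forall>i<m. b i \<in> S) \<and>
     (\<forall>s\<in>S. \<exists>!a. (\<forall>i\<ge>m. a i = 0) \<and> s = (\<lambda>x. \<Sum>i<m. a i * b i x))"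

definition endo_det ::
  "('x \<Rightarrow> complex) set \<Rightarrow> (('x \<Rightarrow> complex) \<Rightarrow> 'x \<Rightarrow> complex) \<Rightarrow> complex" where
  "endo_det S T = (THE d. \<exists>m b M. complex_basis S m b \<and> M \<in> carrier_mat m m \<and>
     (\<forall>j<m. T (b j) = (\<lambda>x. \<Sum>i<m. M $$ (i, j) * b i x)) \<and> d = Determinant.det M)"


section \<open>The section and its Clifford action\<close>

definition lag_section ::
  "nat \<Rightarrow> (('a, 'e::euclidean_space) chart \<Rightarrow> 'a \<Rightarrow> 'e \<Rightarrow> 'e \<Rightarrow> real) \<Rightarrow>
   (('a, 'e) chart \<Rightarrow> 'a \<Rightarrow> 'e \<Rightarrow> 'e) \<Rightarrow> ('a \<Rightarrow> real) \<Rightarrow> ('a, 'e) chart \<Rightarrow> 'a \<Rightarrow>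
   ('e list \<Rightarrow> complex) set" where
  "lag_section n \<omega> J u c p =
     (let g = gromov_metric \<omega> J c p in
        cl_scal g (complex_of_real (Laplacian \<omega> J u c p / 2)) \<oplus>\<^bsub>Cl g\<^esub>
        (cl_scal g \<i> \<otimes>\<^bsub>Cl g\<^esub> H_skew n g (J c p) (Hess \<omega> J u c p)))"

end

theory Submission
  imports Defs
begin

text \<open>
  The complex lines spanned by the vectors of a unitary basis \<open>e\<^sub>1, \<dots>, e\<^sub>n\<close> that diagonalises the skew
  part of the Hessian make the spinor space a fermionic Fock space: with \<open>\<theta>\<^sub>k\<close> the \<open>(0,1)\<close>-form of
  \<open>e\<^sub>k\<close> and \<open>\<iota>\<^sub>k\<close> the contraction, \<open>\<theta>\<^sub>k \<and> \<cdot>\<close> and \<open>\<iota>\<^sub>k\<close> satisfy the canonical anticommutation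
  relations, and \<open>i e\<^sub>k \<cdot> J e\<^sub>k\<close> acts as \<open>\<iota>\<^sub>k \<theta>\<^sub>k - \<theta>\<^sub>k \<iota>\<^sub>k\<close>. On the monomial indexed by a subset \<open>I\<close> this is
  \<open>-1\<close> if \<open>k \<in> I\<close> and \<open>1\<close> otherwise, so the section is diagonal with eigenvalues
  \<open>\<mu> \<plusminus> \<lambda>\<^sub>1 \<plusminus> \<dots> \<plusminus> \<lambda>\<^sub>n\<close>. The bivector is independent of the frame because the endomorphism that it
  represents sends each eigenvector \<open>w\<close> of the skew part, with eigenvalue \<open>c\<close>, to \<open>\<bar>c\<bar> J w\<close>; since the
  determinant depends only on the bivector, this also shows that the product defining the
  Monge-Ampere operator is independent of the frame.
\<close>

section \<open>Antilinear alternating forms\<close>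

text \<open>The obstacle is that \<open>clifford_act\<close>, \<open>endo_det\<close>,
  \<open>H_skew\<close> and \<open>M_Lag\<close> are definite descriptions, so each needs existence
  and uniqueness before it can be computed. For \<open>clifford_act\<close> the Clifford ideal has
  to act by zero, which is shown on alternating antilinear forms; everything is therefore restricted
  to them. For \<open>endo_det\<close> the basis and even its length are quantified. For
  \<open>H_skew\<close> an equality in the quotient ring is required. No basis of the Clifford
  algebra and no faithfulness of the spinor representation is established for it: each bivector is
  rewritten modulo the ideal as a combination of two-letter words in the fixed basis, whose
  coefficients are read off from the endomorphism. Existence of a frame rests on the symmetry of the
  Hessian, that is on commuting second derivatives and vanishing torsion, and on the fact that
  \<open>J\<close> exchanges opposite eigenvalues of the skew part, so that a largest eigenvalue is
  nonnegative.\<close>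

definition antilinear_covector :: "('e::real_vector \<Rightarrow> 'e) \<Rightarrow> ('e \<Rightarrow> complex) \<Rightarrow> bool" where
  "antilinear_covector J \<theta> \<longleftrightarrow> linear \<theta> \<and> (\<forall>v. \<theta> (J v) = - \<i> * \<theta> v)"

text \<open>The conditions of \<open>forms0\<close> with the degree left free. Exterior
  multiplication and contraction shift the degree, so one space closed under both spares the
  bookkeeping; that no degree above \<open>n\<close> occurs is recovered in
  \<open>spinors_eq_antiforms\<close>.\<close>

definition antiforms :: "('e::real_vector \<Rightarrow> 'e) \<Rightarrow> ('e list \<Rightarrow> complex) set" where
  "antiforms J = {s.
     (\<forall>x y. linear (\<lambda>v. s (x @ v # y))) \<and>
     (\<forall>x y z v. s (x @ v # y @ v # z) = 0) \<and>
     (\<forall>x y v. s (x @ J v # y) = - \<i> * s (x @ v # y))}"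

lemma ext_mult_Nil [simp]: "ext_mult \<theta> s [] = 0"
  by (simp add: ext_mult_def)

text \<open>The Leibniz rule for contraction by \<open>v\<close>, read as a recursion on the
  argument list: \<open>\<theta>\<close> takes either the first argument or a later one. Inductions
  on the list generalise the form, because it is contracted at each step.\<close>

lemma ext_mult_Cons:
  "ext_mult \<theta> s (v # x) = \<theta> v * s x - ext_mult \<theta> (contraction v s) x"
proof -
  have "ext_mult \<theta> s (v # x) = \<theta> v * s x +
      (\<Sum>j<length x. (-1) ^ Suc j * \<theta> (x ! j) * s (v # take j x @ drop (Suc j) x))"
    by (simp add: ext_mult_def sum.lessThan_Suc_shift del: sum.lessThan_Suc)
  also have "\<dots> = \<theta> v * s x - ext_mult \<theta> (contraction v s) x"
    by (simp add: ext_mult_def contraction_def sum_negf)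
  finally show ?thesis .
qed

lemma contraction_ext_mult:
  "contraction v (ext_mult \<theta> s) = (\<lambda>x. \<theta> v * s x - ext_mult \<theta> (contraction v s) x)"
  by (simp add: fun_eq_iff contraction_def[of v "ext_mult \<theta> s"] ext_mult_Cons)

lemma ext_mult_sum:
  "ext_mult \<theta> (\<lambda>x. \<Sum>i\<in>I. c i * s i x) = (\<lambda>x. \<Sum>i\<in>I. c i * ext_mult \<theta> (s i) x)"
  unfolding ext_mult_def fun_eq_iff
  by (auto simp: sum_distrib_left algebra_simps intro: sum.swap)

lemma ext_mult_add:
  "ext_mult \<theta> (\<lambda>x. s x + t x) = (\<lambda>x. ext_mult \<theta> s x + ext_mult \<theta> t x)"
  by (simp add: fun_eq_iff ext_mult_def algebra_simps sum.distrib)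

lemma ext_mult_diff:
  "ext_mult \<theta> (\<lambda>x. s x - t x) = (\<lambda>x. ext_mult \<theta> s x - ext_mult \<theta> t x)"
  by (simp add: fun_eq_iff ext_mult_def algebra_simps sum_subtractf)

lemma ext_mult_scale:
  "ext_mult \<theta> (\<lambda>x. c * s x) = (\<lambda>x. c * ext_mult \<theta> s x)"
  by (simp add: fun_eq_iff ext_mult_def sum_distrib_left algebra_simps)

lemma ext_mult_scale_covector: "ext_mult (\<lambda>w. c * \<theta> w) s = (\<lambda>x. c * ext_mult \<theta> s x)"
  by (simp add: fun_eq_iff ext_mult_def sum_distrib_left algebra_simps)

lemma ext_mult_zero: "ext_mult \<theta> (\<lambda>x. 0) = (\<lambda>x. 0)"
  by (simp add: fun_eq_iff ext_mult_def)

text \<open>Two uses of the Leibniz rule reduce the claim at \<open>v # x\<close> to the claim at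
  \<open>x\<close> for the contracted form; the other terms merely exchange \<open>\<theta>\<close>
  and \<open>\<eta>\<close>.\<close>

lemma ext_mult_anticommute:
  "ext_mult \<theta> (ext_mult \<eta> s) x = - ext_mult \<eta> (ext_mult \<theta> s) x"
  by (induction x arbitrary: s)
    (simp_all add: ext_mult_Cons contraction_ext_mult ext_mult_diff ext_mult_scale)

lemma ext_mult_square: "ext_mult \<theta> (ext_mult \<theta> s) = (\<lambda>x. 0)"
  using ext_mult_anticommute[of \<theta> \<theta> s] by (simp add: fun_eq_iff eq_neg_iff_add_eq_0)

lemma antiforms_linear: "s \<in> antiforms J \<Longrightarrow> linear (\<lambda>v. s (x @ v # y))"
  by (simp add: antiforms_def)

lemma antiforms_alternating: "s \<in> antiforms J \<Longrightarrow> s (x @ v # y @ v # z) = 0"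
  by (simp add: antiforms_def)

lemma antiforms_antilinear: "s \<in> antiforms J \<Longrightarrow> s (x @ J v # y) = - \<i> * s (x @ v # y)"
  by (simp add: antiforms_def)

text \<open>Polarisation: expanding the vanishing value at \<open>v + w\<close> in both slots leaves
  the two mixed terms.\<close>

lemma antiforms_swap:
  assumes "s \<in> antiforms J"
  shows "s (x @ v # w # y) = - s (x @ w # v # y)"
proof -
  have l1: "linear (\<lambda>u. s (x @ u # (v + w) # y))" by (rule antiforms_linear[OF assms])
  have l2: "linear (\<lambda>u. s (x @ v # u # y))"
    using antiforms_linear[OF assms, of "x @ [v]" y] by simp
  have l3: "linear (\<lambda>u. s (x @ w # u # y))"
    using antiforms_linear[OF assms, of "x @ [w]" y] by simp
  have z: "s (x @ u # u # y) = 0" for u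
    using antiforms_alternating[OF assms, of x u "[]" y] by simp
  show ?thesis
    using z[of "v + w"] z[of v] z[of w]
    by (simp add: linear_add[OF l1] linear_add[OF l2] linear_add[OF l3] eq_neg_iff_add_eq_0)
qed

lemma antiforms_contraction:
  assumes "s \<in> antiforms J"
  shows "contraction v s \<in> antiforms J"
proof -
  have "linear (\<lambda>w. s (v # x @ w # y))" for x y
    using antiforms_linear[OF assms, of "v # x" y] by simp
  moreover have "s (v # x @ w # y @ w # z) = 0" for x y z w
    using antiforms_alternating[OF assms, of "v # x" w y z] by simp
  moreover have "s (v # x @ J w # y) = - \<i> * s (v # x @ w # y)" for x y w
    using antiforms_antilinear[OF assms, of "v # x" w y] by simp
  ultimately show ?thesis
    by (simp add: antiforms_def contraction_def)
qed

lemma contraction_twice: "s \<in> antiforms J \<Longrightarrow> contraction v (contraction v s) = (\<lambda>x. 0)"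
  using antiforms_alternating[of s J "[]" v "[]"] by (simp add: contraction_def fun_eq_iff)

lemma contraction_anticommute:
  "s \<in> antiforms J \<Longrightarrow> contraction v (contraction w s) = (\<lambda>x. - contraction w (contraction v s) x)"
  using antiforms_swap[of s J "[]" w v] by (simp add: contraction_def fun_eq_iff)

lemma contraction_add: "contraction v (\<lambda>x. s x + t x) = (\<lambda>x. contraction v s x + contraction v t x)"
  by (simp add: contraction_def fun_eq_iff)

lemma contraction_diff: "contraction v (\<lambda>x. s x - t x) = (\<lambda>x. contraction v s x - contraction v t x)"
  by (simp add: contraction_def fun_eq_iff)

lemma contraction_scale: "contraction v (\<lambda>x. c * s x) = (\<lambda>x. c * contraction v s x)"
  by (simp add: contraction_def fun_eq_iff)

lemma contraction_zero: "contraction v (\<lambda>x. 0) = (\<lambda>x. 0)"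
  by (simp add: contraction_def fun_eq_iff)

lemma contraction_plus_vec:
  assumes "s \<in> antiforms J"
  shows "contraction (v + w) s = (\<lambda>x. contraction v s x + contraction w s x)"
  using linear_add[OF antiforms_linear[OF assms, of "[]"]] by (simp add: contraction_def fun_eq_iff)

lemma contraction_scaleR_vec:
  assumes "s \<in> antiforms J"
  shows "contraction (a *\<^sub>R v) s = (\<lambda>x. complex_of_real a * contraction v s x)"
  using linear_scale[OF antiforms_linear[OF assms, of "[]"]]
  by (simp add: contraction_def fun_eq_iff scaleR_conv_of_real)

lemma contraction_J:
  assumes "s \<in> antiforms J"
  shows "contraction (J v) s = (\<lambda>x. - \<i> * contraction v s x)"
  using antiforms_antilinear[OF assms, of "[]"] by (simp add: contraction_def fun_eq_iff)

lemma contraction_sum: "contraction v (\<lambda>x. \<Sum>i\<in>I. a i * s i x) = (\<lambda>x. \<Sum>i\<in>I. a i * contraction v (s i) x)"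
  by (simp add: contraction_def fun_eq_iff)

lemma linear_complex_combination:
  fixes f h :: "'e::real_vector \<Rightarrow> complex"
  assumes "linear f" "linear h"
  shows "linear (\<lambda>v. a * f v + b * h v)"
  using assms by (simp add: linear_iff algebra_simps)

lemma antiforms_combination:
  assumes "s \<in> antiforms J" "t \<in> antiforms J"
  shows "(\<lambda>x. a * s x + b * t x) \<in> antiforms J"
  using assms unfolding antiforms_def
  by (auto intro!: linear_complex_combination simp: algebra_simps)

lemma antiforms_add: "s \<in> antiforms J \<Longrightarrow> t \<in> antiforms J \<Longrightarrow> (\<lambda>x. s x + t x) \<in> antiforms J"
  using antiforms_combination[of s J t 1 1] by simp

lemma antiforms_diff: "s \<in> antiforms J \<Longrightarrow> t \<in> antiforms J \<Longrightarrow> (\<lambda>x. s x - t x) \<in> antiforms J"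
  using antiforms_combination[of s J t 1 "-1"] by simp

lemma antiforms_scale: "s \<in> antiforms J \<Longrightarrow> (\<lambda>x. c * s x) \<in> antiforms J"
  using antiforms_combination[of s J s c 0] by simp

lemma antiforms_zero: "(\<lambda>x. 0) \<in> antiforms J"
  by (simp add: antiforms_def linear_zero)

lemma antiforms_sum:
  "(\<And>i. i \<in> I \<Longrightarrow> s i \<in> antiforms J) \<Longrightarrow> (\<lambda>x. \<Sum>i\<in>I. c i * s i x) \<in> antiforms J"
  by (induction I rule: infinite_finite_induct)
    (simp_all add: antiforms_zero antiforms_add antiforms_scale)

lemma antiforms_vacuum: "(\<lambda>x. if x = [] then 1 else 0) \<in> antiforms J"
  by (auto simp: antiforms_def linear_zero)

lemma antiforms_move:
  assumes "s \<in> antiforms J"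
  shows "s (y @ v # z) = (-1) ^ length y * s (v # y @ z)"
  using assms
proof (induction y arbitrary: s)
  case (Cons a y)
  have "s ((a # y) @ v # z) = contraction a s (y @ v # z)"
    by (simp add: contraction_def)
  also have "\<dots> = (-1) ^ length y * contraction a s (v # y @ z)"
    by (rule Cons.IH[OF antiforms_contraction[OF Cons.prems]])
  also have "contraction a s (v # y @ z) = s (a # v # y @ z)"
    by (simp add: contraction_def)
  also have "s (a # v # y @ z) = - s (v # a # y @ z)"
    using antiforms_swap[OF Cons.prems, of "[]" a v] by simp
  finally show ?case by simp
qed simp

text \<open>Since \<open>t\<close> vanishes once \<open>v\<close> is among its arguments, only the
  term in which \<open>\<theta>\<close> takes the \<open>v\<close> survives. In the application
  \<open>t\<close> is itself a contraction by \<open>v\<close>.\<close>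

lemma ext_mult_at:
  assumes "t \<in> antiforms J" "contraction v t = (\<lambda>x. 0)"
  shows "ext_mult \<theta> t (y @ v # z) = (-1) ^ length y * \<theta> v * t (y @ z)"
  using assms
proof (induction y arbitrary: t)
  case Nil
  then show ?case by (simp add: ext_mult_Cons ext_mult_zero)
next
  case (Cons a y)
  have "t (y @ v # z) = 0"
    using antiforms_move[OF Cons.prems(1), of y v z] Cons.prems(2)
    by (simp add: contraction_def fun_eq_iff)
  have "contraction v (contraction a t) = (\<lambda>x. 0)"
    using contraction_anticommute[OF Cons.prems(1), of v a] Cons.prems(2)
    by (simp add: contraction_zero)
  note IH = Cons.IH[OF antiforms_contraction[OF Cons.prems(1)] this]
  show ?case
    by (simp add: ext_mult_Cons IH \<open>t (y @ v # z) = 0\<close>) (simp add: contraction_def)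
qed

lemma ext_mult_linear_slot:
  assumes "s \<in> antiforms J" "linear \<theta>"
  shows "linear (\<lambda>v. ext_mult \<theta> s (x @ v # y))"
  using assms(1)
proof (induction x arbitrary: s)
  case Nil
  have c: "contraction (v + w) s = (\<lambda>x. contraction v s x + contraction w s x)"
    "contraction (a *\<^sub>R v) s = (\<lambda>x. complex_of_real a * contraction v s x)" for v w a
    by (rule contraction_plus_vec[OF Nil] contraction_scaleR_vec[OF Nil])+
  show ?case
    by (simp add: linear_iff ext_mult_Cons c ext_mult_add ext_mult_scale
        linear_add[OF assms(2)] linear_scale[OF assms(2)] scaleR_conv_of_real algebra_simps)
next
  case (Cons a x)
  show ?case
    using linear_complex_combination[OF antiforms_linear[OF Cons.prems, of x y]
        Cons.IH[OF antiforms_contraction[OF Cons.prems, of a]], of "\<theta> a" "-1"]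
    by (simp add: ext_mult_Cons)
qed

lemma antiforms_ext_mult:
  assumes s: "s \<in> antiforms J" and \<theta>: "antilinear_covector J \<theta>"
  shows "ext_mult \<theta> s \<in> antiforms J"
proof -
  have l: "linear \<theta>" and c: "\<And>v. \<theta> (J v) = - \<i> * \<theta> v"
    using \<theta> by (auto simp: antilinear_covector_def)
  have "ext_mult \<theta> s (x @ J v # y) = - \<i> * ext_mult \<theta> s (x @ v # y)" for x y v
    using s
  proof (induction x arbitrary: s)
    case Nil
    have "contraction (J v) s = (\<lambda>x. - \<i> * contraction v s x)"
      by (rule contraction_J[OF Nil])
    then have "ext_mult \<theta> (contraction (J v) s) = (\<lambda>x. - \<i> * ext_mult \<theta> (contraction v s) x)"
      by (simp only: ext_mult_scale)
    then show ?case
      by (simp add: ext_mult_Cons c algebra_simps)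
  next
    case (Cons a x)
    show ?case
      by (simp add: ext_mult_Cons Cons.IH[OF antiforms_contraction[OF Cons.prems]]
          antiforms_antilinear[OF Cons.prems] algebra_simps)
  qed
  moreover have "ext_mult \<theta> s (x @ v # y @ v # z) = 0" for x y z v
    using s
  proof (induction x arbitrary: s)
    case Nil
    \<comment> \<open>A term is nonzero only if \<open>\<theta>\<close> takes one of the two copies
      of \<open>v\<close>. The choices of the first and of the second copy differ by the sign in
      \<open>antiforms_move\<close>, so they cancel.\<close>
    have "ext_mult \<theta> s (v # y @ v # z) =
        \<theta> v * s (y @ v # z) - (-1) ^ length y * \<theta> v * s (v # y @ z)"
      by (simp add: ext_mult_Cons contraction_twice[OF Nil]
          ext_mult_at[OF antiforms_contraction[OF Nil]])
        (simp add: contraction_def)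
    then show ?case by (simp add: antiforms_move[OF Nil])
  next
    case (Cons a x)
    show ?case
      by (simp add: ext_mult_Cons Cons.IH[OF antiforms_contraction[OF Cons.prems]]
          antiforms_alternating[OF Cons.prems])
  qed
  ultimately show ?thesis
    using ext_mult_linear_slot[OF s l] by (simp add: antiforms_def)
qed

section \<open>Determinants of endomorphisms of complex function spaces\<close>

text \<open>Being a complex subspace, phrased with families on an initial segment of the naturals to
  match \<open>complex_basis\<close>; the case \<open>m = 0\<close> covers the zero
  function.\<close>

definition combination_closed :: "('x \<Rightarrow> complex) set \<Rightarrow> bool" where
  "combination_closed S \<longleftrightarrow>
     (\<forall>(m::nat) a s. (\<forall>i<m. s i \<in> S) \<longrightarrow> (\<lambda>x. \<Sum>i<m. a i * s i x) \<in> S)"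

text \<open>Linearity is asked on \<open>S\<close> alone, because the Clifford action of a class is
  controlled only on spinors.\<close>

definition preserves_combinations ::
  "('x \<Rightarrow> complex) set \<Rightarrow> (('x \<Rightarrow> complex) \<Rightarrow> 'x \<Rightarrow> complex) \<Rightarrow> bool" where
  "preserves_combinations S T \<longleftrightarrow>
     (\<forall>(m::nat) a s. (\<forall>i<m. s i \<in> S) \<longrightarrow>
        T (\<lambda>x. \<Sum>i<m. a i * s i x) = (\<lambda>x. \<Sum>i<m. a i * T (s i) x))"

lemma combination_closedD:
  "combination_closed S \<Longrightarrow> (\<And>i. i < m \<Longrightarrow> s i \<in> S) \<Longrightarrow> (\<lambda>x. \<Sum>i<(m::nat). a i * s i x) \<in> S"
  by (auto simp: combination_closed_def)

lemma preserves_combinationsD: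
  "preserves_combinations S T \<Longrightarrow> (\<And>i. i < m \<Longrightarrow> s i \<in> S) \<Longrightarrow>
     T (\<lambda>x. \<Sum>i<(m::nat). a i * s i x) = (\<lambda>x. \<Sum>i<m. a i * T (s i) x)"
  by (auto simp: preserves_combinations_def)

lemma complex_basisI:
  assumes "\<And>i. i < m \<Longrightarrow> b i \<in> S"
    and span: "\<And>s. s \<in> S \<Longrightarrow> \<exists>a. s = (\<lambda>x. \<Sum>i<m. a i * b i x)"
    and indep: "\<And>a i. (\<lambda>x. \<Sum>i<m. a i * b i x) = (\<lambda>x. 0) \<Longrightarrow> i < m \<Longrightarrow> a i = 0"
  shows "complex_basis S m b"
  unfolding complex_basis_def
proof (intro conjI ballI allI impI)
  fix s assume "s \<in> S"
  then obtain a where a: "s = (\<lambda>x. \<Sum>i<m. a i * b i x)" using span by blast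
  show "\<exists>!a. (\<forall>i\<ge>m. a i = 0) \<and> s = (\<lambda>x. \<Sum>i<m. a i * b i x)"
  proof (rule ex1I[of _ "\<lambda>i. if i < m then a i else 0"])
    show "(\<forall>i\<ge>m. (if i < m then a i else 0) = 0) \<and>
        s = (\<lambda>x. \<Sum>i<m. (if i < m then a i else 0) * b i x)"
      using a by simp
  next
    fix c assume c: "(\<forall>i\<ge>m. c i = 0) \<and> s = (\<lambda>x. \<Sum>i<m. c i * b i x)"
    have "(\<lambda>x. \<Sum>i<m. (c i - a i) * b i x) = (\<lambda>x. 0)"
      using c a by (simp add: fun_eq_iff algebra_simps sum_subtractf)
    then have "c i = a i" if "i < m" for i
      using indep[of "\<lambda>i. c i - a i" i] that by simp
    then show "c = (\<lambda>i. if i < m then a i else 0)"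
      using c by (auto simp: fun_eq_iff)
  qed
qed (use assms(1) in simp)

lemma complex_basis_span:
  "complex_basis S m b \<Longrightarrow> s \<in> S \<Longrightarrow> \<exists>a. s = (\<lambda>x. \<Sum>i<m. a i * b i x)"
  unfolding complex_basis_def by blast

lemma complex_basis_in: "complex_basis S m b \<Longrightarrow> i < m \<Longrightarrow> b i \<in> S"
  unfolding complex_basis_def by blast

lemma ex1_unique: "\<exists>!x. P x \<Longrightarrow> P a \<Longrightarrow> P b \<Longrightarrow> a = b"
  by auto

lemma complex_basis_unique:
  assumes "complex_basis S m b" "combination_closed S"
    and eq: "(\<lambda>x. \<Sum>i<m. a i * b i x) = (\<lambda>x. \<Sum>i<m. c i * b i x)" and "i < m"
  shows "a i = c i"
proof -
  \<comment> \<open>\<open>complex_basis\<close> requires coefficients to vanish from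
    \<open>m\<close> on, so both families are truncated before its uniqueness clause
    applies.\<close>
  let ?r = "\<lambda>a i. if i < m then a i else (0::complex)"
  let ?Q = "\<lambda>c. (\<forall>i\<ge>m. c i = 0) \<and> (\<lambda>x. \<Sum>i<m. a i * b i x) = (\<lambda>x. \<Sum>i<m. c i * b i x)"
  have "(\<lambda>x. \<Sum>i<m. a i * b i x) \<in> S"
    using assms(1,2) by (intro combination_closedD complex_basis_in)
  then have 1: "\<exists>!c. ?Q c"
    using assms(1) unfolding complex_basis_def by blast
  have 2: "?Q (?r a)" by simp
  have 3: "?Q (?r c)" using eq by simp
  have "?r a = ?r c" by (rule ex1_unique[of ?Q, OF 1 2 3])
  then have "?r a i = ?r c i" by (rule fun_cong)
  then show ?thesis using \<open>i < m\<close> by simp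
qed

section \<open>Invariance of dimension and determinant under change of basis\<close>

lemma right_inverse_mat_dim_le:
  fixes P Q :: "complex mat"
  assumes P: "P \<in> carrier_mat m k" and Q: "Q \<in> carrier_mat k m" and PQ: "P * Q = 1\<^sub>m m"
  shows "m \<le> k"
proof (rule ccontr)
  assume "\<not> m \<le> k"
  then have km: "k < m" by simp
  \<comment> \<open>Zero padding makes both factors square and keeps the product. A right inverse of
    a square matrix is a left inverse, but the padded row and column of index \<open>k\<close> put a
    zero on the diagonal of \<open>Q' * P'\<close>.\<close>
  define P' where "P' = mat m m (\<lambda>(i,j). if j < k then P $$ (i,j) else 0)"
  define Q' where "Q' = mat m m (\<lambda>(i,j). if i < k then Q $$ (i,j) else 0)"
  have c: "P' \<in> carrier_mat m m" "Q' \<in> carrier_mat m m"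
    by (auto simp: P'_def Q'_def)
  have "P' * Q' = P * Q"
  proof (rule eq_matI)
    fix i j assume "i < dim_row (P * Q)" "j < dim_col (P * Q)"
    then have ij: "i < m" "j < m" using P Q by auto
    have "(P' * Q') $$ (i,j) = (\<Sum>r = 0..<m. if r < k then P $$ (i,r) * Q $$ (r,j) else 0)"
      using ij by (auto simp: P'_def Q'_def scalar_prod_def intro!: sum.cong)
    also have "\<dots> = (\<Sum>r = 0..<k. P $$ (i,r) * Q $$ (r,j))"
      using km by (intro sum.mono_neutral_cong_right) auto
    also have "\<dots> = (P * Q) $$ (i,j)"
      using ij P Q by (simp add: scalar_prod_def)
    finally show "(P' * Q') $$ (i,j) = (P * Q) $$ (i,j)" .
  qed (use P Q c in auto)
  then have "Q' * P' = 1\<^sub>m m"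
    using PQ c by (metis mat_mult_left_right_inverse)
  moreover have "(Q' * P') $$ (k,k) = 0"
    using km by (simp add: P'_def Q'_def scalar_prod_def)
  ultimately show False using km by simp
qed

lemma complex_basis_transition:
  assumes b: "complex_basis S m b" and b': "complex_basis S m' b'" and S: "combination_closed S"
    and P: "\<And>j. j < m' \<Longrightarrow> b' j = (\<lambda>x. \<Sum>i<m. P $$ (i,j) * b i x)" "P \<in> carrier_mat m m'"
    and Q: "\<And>i. i < m \<Longrightarrow> b i = (\<lambda>x. \<Sum>j<m'. Q $$ (j,i) * b' j x)" "Q \<in> carrier_mat m' m"
  shows "P * Q = 1\<^sub>m m"
proof (rule eq_matI)
  fix k i assume "k < dim_row (1\<^sub>m m)" "i < dim_col (1\<^sub>m m)"
  then have ki: "k < m" "i < m" by auto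
  have "(\<lambda>x. \<Sum>r<m. (if r = i then 1 else 0) * b r x) = b i"
    using ki by (simp add: if_distrib[of "\<lambda>c. c * _"] cong: if_cong)
  also have "b i = (\<lambda>x. \<Sum>j<m'. Q $$ (j,i) * b' j x)" by (rule Q(1)[OF ki(2)])
  also have "\<dots> = (\<lambda>x. \<Sum>j<m'. Q $$ (j,i) * (\<Sum>r<m. P $$ (r,j) * b r x))"
    by (intro ext sum.cong refl arg_cong2[where f="(*)"] fun_cong[OF P(1)]) auto
  also have "\<dots> = (\<lambda>x. \<Sum>j<m'. \<Sum>r<m. P $$ (r,j) * Q $$ (j,i) * b r x)"
    by (simp add: sum_distrib_left algebra_simps)
  also have "\<dots> = (\<lambda>x. \<Sum>r<m. \<Sum>j<m'. P $$ (r,j) * Q $$ (j,i) * b r x)"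
    by (intro ext sum.swap)
  also have "\<dots> = (\<lambda>x. \<Sum>r<m. (\<Sum>j<m'. P $$ (r,j) * Q $$ (j,i)) * b r x)"
    by (simp add: sum_distrib_right)
  finally have eq: "(\<lambda>x. \<Sum>r<m. (if r = i then 1 else 0) * b r x) =
      (\<lambda>x. \<Sum>r<m. (\<Sum>j<m'. P $$ (r,j) * Q $$ (j,i)) * b r x)" .
  from complex_basis_unique[OF b S eq ki(1)]
  show "(P * Q) $$ (k,i) = 1\<^sub>m m $$ (k,i)"
    using ki P Q by (simp add: scalar_prod_def lessThan_atLeast0)
qed (use P Q in auto)

lemma complex_basis_transition_mat:
  assumes b: "complex_basis S m b" and b': "complex_basis S m' b'"
  shows "\<exists>P\<in>carrier_mat m m'. \<forall>j<m'. b' j = (\<lambda>x. \<Sum>i<m. P $$ (i,j) * b i x)"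
proof -
  obtain a where a: "\<And>j. j < m' \<Longrightarrow> b' j = (\<lambda>x. \<Sum>i<m. a j i * b i x)"
    using complex_basis_span[OF b complex_basis_in[OF b']] by metis
  show ?thesis
    by (rule bexI[of _ "mat m m' (\<lambda>(i,j). a j i)"]) (auto simp: a intro!: ext sum.cong)
qed

text \<open>Expanding \<open>T (b' j)\<close> in the basis \<open>b\<close> in two ways gives
  \<open>M * P = P * M'\<close>, and \<open>P\<close> is invertible. The two lengths may differ a
  priori, as \<open>endo_det\<close> quantifies over the length as well, so \<open>m' = m\<close>
  has to come first.\<close>

lemma endo_matrix_det_unique:
  assumes b: "complex_basis S m b" and b': "complex_basis S m' b'" and S: "combination_closed S"
    and T: "preserves_combinations S T"
    and M: "M \<in> carrier_mat m m" "\<forall>j<m. T (b j) = (\<lambda>x. \<Sum>i<m. M $$ (i,j) * b i x)"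
    and M': "M' \<in> carrier_mat m' m'" "\<forall>j<m'. T (b' j) = (\<lambda>x. \<Sum>i<m'. M' $$ (i,j) * b' i x)"
  shows "Determinant.det M' = Determinant.det M"
proof -
  obtain P where P: "P \<in> carrier_mat m m'"
    "\<And>j. j < m' \<Longrightarrow> b' j = (\<lambda>x. \<Sum>i<m. P $$ (i,j) * b i x)"
    using complex_basis_transition_mat[OF b b'] by blast
  obtain Q where Q: "Q \<in> carrier_mat m' m"
    "\<And>j. j < m \<Longrightarrow> b j = (\<lambda>x. \<Sum>i<m'. Q $$ (i,j) * b' i x)"
    using complex_basis_transition_mat[OF b' b] by blast
  have PQ: "P * Q = 1\<^sub>m m" and QP: "Q * P = 1\<^sub>m m'"
    using complex_basis_transition[OF b b' S P(2,1) Q(2,1)]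
      complex_basis_transition[OF b' b S Q(2,1) P(2,1)] by auto
  have m: "m' = m"
    using right_inverse_mat_dim_le[OF P(1) Q(1) PQ] right_inverse_mat_dim_le[OF Q(1) P(1) QP]
    by simp
  note P = P[unfolded m] and Q = Q[unfolded m] and M' = M'[unfolded m] and QP = QP[unfolded m]
  have "M * P = P * M'"
  proof (rule eq_matI)
    fix k j assume "k < dim_row (P * M')" "j < dim_col (P * M')"
    then have kj: "k < m" "j < m" using P M' by auto
    have "(\<lambda>x. \<Sum>r<m. (\<Sum>i<m. M $$ (r,i) * P $$ (i,j)) * b r x) =
        (\<lambda>x. \<Sum>r<m. \<Sum>i<m. P $$ (i,j) * (M $$ (r,i) * b r x))"
      by (simp add: fun_eq_iff sum_distrib_left sum_distrib_right mult_ac)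
    also have "\<dots> = (\<lambda>x. \<Sum>i<m. \<Sum>r<m. P $$ (i,j) * (M $$ (r,i) * b r x))"
      by (intro ext sum.swap)
    also have "\<dots> = (\<lambda>x. \<Sum>i<m. P $$ (i,j) * (\<Sum>r<m. M $$ (r,i) * b r x))"
      by (simp add: sum_distrib_left)
    also have "\<dots> = (\<lambda>x. \<Sum>i<m. P $$ (i,j) * T (b i) x)"
      by (intro ext sum.cong refl) (simp add: M(2))
    also have "\<dots> = T (b' j)"
      unfolding P(2)[OF kj(2)] by (rule preserves_combinationsD[OF T complex_basis_in[OF b], symmetric])
    also have "\<dots> = (\<lambda>x. \<Sum>i<m. M' $$ (i,j) * b' i x)"
      by (simp add: M'(2) kj)
    also have "\<dots> = (\<lambda>x. \<Sum>i<m. M' $$ (i,j) * (\<Sum>r<m. P $$ (r,i) * b r x))"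
      by (intro ext sum.cong refl arg_cong2[where f="(*)"] fun_cong[OF P(2)]) auto
    also have "\<dots> = (\<lambda>x. \<Sum>i<m. \<Sum>r<m. P $$ (r,i) * M' $$ (i,j) * b r x)"
      by (simp add: sum_distrib_left algebra_simps)
    also have "\<dots> = (\<lambda>x. \<Sum>r<m. \<Sum>i<m. P $$ (r,i) * M' $$ (i,j) * b r x)"
      by (intro ext sum.swap)
    also have "\<dots> = (\<lambda>x. \<Sum>r<m. (\<Sum>i<m. P $$ (r,i) * M' $$ (i,j)) * b r x)"
      by (simp add: sum_distrib_right)
    finally have eq: "(\<lambda>x. \<Sum>r<m. (\<Sum>i<m. M $$ (r,i) * P $$ (i,j)) * b r x) =
        (\<lambda>x. \<Sum>r<m. (\<Sum>i<m. P $$ (r,i) * M' $$ (i,j)) * b r x)" .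
    from complex_basis_unique[OF b S eq kj(1)]
    show "(M * P) $$ (k,j) = (P * M') $$ (k,j)"
      using kj P M M' by (simp add: scalar_prod_def lessThan_atLeast0)
  qed (use P M M' in auto)
  then have "Determinant.det M * Determinant.det P = Determinant.det P * Determinant.det M'"
    by (metis Determinant.det_mult[OF M(1) P(1)] Determinant.det_mult[OF P(1) M'(1)])
  moreover have "Determinant.det P \<noteq> 0"
    using Determinant.det_mult[OF P(1) Q(1)] PQ by auto
  ultimately show ?thesis by simp
qed

lemma endo_det_eqI:
  assumes "complex_basis S m b" "combination_closed S" "preserves_combinations S T"
    and "M \<in> carrier_mat m m" "\<forall>j<m. T (b j) = (\<lambda>x. \<Sum>i<m. M $$ (i,j) * b i x)"
  shows "endo_det S T = Determinant.det M"
  unfolding endo_det_def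
  using assms by (intro the_equality) (blast intro: endo_matrix_det_unique)+

lemma endo_det_diagonal:
  assumes "complex_basis S m b" "combination_closed S" "preserves_combinations S T"
    and ev: "\<And>j. j < m \<Longrightarrow> T (b j) = (\<lambda>x. ev j * b j x)"
  shows "endo_det S T = (\<Prod>i<m. ev i)"
proof -
  define M where "M = mat m m (\<lambda>(i,j). if i = j then ev j else 0)"
  have M: "M \<in> carrier_mat m m" by (simp add: M_def)
  have "endo_det S T = Determinant.det M"
  proof (rule endo_det_eqI[OF assms(1-3) M], intro allI impI ext)
    fix j x assume "j < m"
    then show "T (b j) x = (\<Sum>i<m. M $$ (i,j) * b i x)"
      by (simp add: ev M_def if_distrib[of "\<lambda>c. c * _"] cong: if_cong)
  qed
  also have "\<dots> = prod_list (diag_mat M)"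
    by (rule det_upper_triangular[OF _ M]) (auto simp: M_def)
  also have "\<dots> = (\<Prod>i<m. ev i)"
    using M by (simp add: diag_mat_def M_def lessThan_atLeast0 prod.distinct_set_conv_list[symmetric])
  finally show ?thesis .
qed

section \<open>Fock basis of the spinor space\<close>

lemma sum_lessThan_add: "(\<Sum>i<m + k. f i) = (\<Sum>i<m. f i) + (\<Sum>i<k. f (m + i))"
  for f :: "nat \<Rightarrow> 'b::comm_monoid_add"
  by (induction k) (simp_all add: add.assoc)

lemma prod_lessThan_add: "(\<Prod>i<m + k. f i) = (\<Prod>i<m. f i) * (\<Prod>i<k. f (m + i))"
  for f :: "nat \<Rightarrow> 'b::comm_monoid_mult"
  by (induction k) (simp_all add: mult.assoc)

lemma prod_signs_Suc:
  "(\<Prod>s\<in>{..<Suc j} \<rightarrow>\<^sub>E {-1, 1}. \<mu> + (\<Sum>k<Suc j. s k * l k)) =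
   (\<Prod>s\<in>{..<j} \<rightarrow>\<^sub>E {-1, 1}. \<mu> + l j + (\<Sum>k<j. s k * l k)) *
   (\<Prod>s\<in>{..<j} \<rightarrow>\<^sub>E {-1, 1}. \<mu> - l j + (\<Sum>k<j. s k * l k))"
  for l :: "nat \<Rightarrow> real"
proof -
  let ?P = "{..<j} \<rightarrow>\<^sub>E {-1, 1::real}"
  let ?h = "\<lambda>(y, s). s(j := y)"
  have *: "{..<Suc j} \<rightarrow>\<^sub>E {-1, 1::real} = ?h ` ({-1, 1} \<times> ?P)"
    unfolding lessThan_Suc PiE_insert_eq ..
  have inj: "inj_on ?h ({-1, 1} \<times> ?P)"
    by (rule inj_combinator[of j "{..<j}" "\<lambda>_. {-1, 1::real}"]) simp
  have "(\<Prod>s\<in>{..<Suc j} \<rightarrow>\<^sub>E {-1, 1}. \<mu> + (\<Sum>k<Suc j. s k * l k)) =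
      (\<Prod>(y, s)\<in>{-1, 1} \<times> ?P. \<mu> + (\<Sum>k<j. s k * l k) + y * l j)"
    unfolding * prod.reindex[OF inj]
  proof (intro prod.cong refl, clarify)
    fix y s
    have "(\<Sum>k<j. (s(j := y)) k * l k) = (\<Sum>k<j. s k * l k)"
      by (intro sum.cong) auto
    then show "((\<lambda>s. \<mu> + (\<Sum>k<Suc j. s k * l k)) \<circ> ?h) (y, s) =
        \<mu> + (\<Sum>k<j. s k * l k) + y * l j"
      by (simp add: add.assoc)
  qed
  also have "\<dots> = (\<Prod>y\<in>{-1, 1}. \<Prod>s\<in>?P. \<mu> + (\<Sum>k<j. s k * l k) + y * l j)"
    by (rule prod.cartesian_product[symmetric])
  also have "\<dots> = (\<Prod>s\<in>?P. \<mu> + l j + (\<Sum>k<j. s k * l k)) *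
      (\<Prod>s\<in>?P. \<mu> - l j + (\<Sum>k<j. s k * l k))"
    by (simp add: algebra_simps)
  finally show ?thesis .
qed

section \<open>Hermitian linear algebra and Clifford multiplication on one tangent space\<close>

locale hermitian_space =
  fixes n :: nat and g :: "'e::euclidean_space \<Rightarrow> 'e \<Rightarrow> real" and J :: "'e \<Rightarrow> 'e"
  assumes DIM_eq: "DIM('e) = 2 * n"
    and g_bilinear: "bilinear g"
    and g_sym: "g v w = g w v"
    and g_pos: "v \<noteq> 0 \<Longrightarrow> 0 < g v v"
    and J_linear: "linear J"
    and J_J [simp]: "J (J v) = - v"
    and g_J_J [simp]: "g (J v) (J w) = g v w"
begin

lemmas g_simps [simp] =
  bilinear_ladd[OF g_bilinear] bilinear_radd[OF g_bilinear]
  bilinear_lmul[OF g_bilinear] bilinear_rmul[OF g_bilinear]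
  bilinear_lneg[OF g_bilinear] bilinear_rneg[OF g_bilinear]
  bilinear_lsub[OF g_bilinear] bilinear_rsub[OF g_bilinear]
  bilinear_lzero[OF g_bilinear] bilinear_rzero[OF g_bilinear]

lemmas J_simps [simp] =
  linear_add[OF J_linear] linear_scale[OF J_linear] linear_neg[OF J_linear]
  linear_diff[OF J_linear] linear_0[OF J_linear]

lemma g_linear: "linear (g v)" "linear (\<lambda>v. g v w)"
  using g_bilinear by (auto simp: bilinear_def)

lemma g_J_left: "g (J v) w = - g v (J w)"
  using g_J_J[of v "J w"] by simp

lemma g_self_J [simp]: "g v (J v) = 0"
  using g_J_left[of v v] g_sym[of v "J v"] by simp

lemma antilinear_covector01: "antilinear_covector J (covector01 g J v)"
  unfolding antilinear_covector_def covector01_def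
  by (auto simp: linear_iff algebra_simps scaleR_conv_of_real)

lemma covector01_self: "covector01 g J v v = complex_of_real (g v v)"
  by (simp add: covector01_def)

lemma covector01_J: "covector01 g J (J v) = (\<lambda>w. \<i> * covector01 g J v w)"
  by (simp add: covector01_def fun_eq_iff g_J_left algebra_simps)

lemma ext_mult_covector01_plus:
  "ext_mult (covector01 g J (v + w)) s =
     (\<lambda>x. ext_mult (covector01 g J v) s x + ext_mult (covector01 g J w) s x)"
  by (simp add: fun_eq_iff ext_mult_def covector01_def sum.distrib algebra_simps)

lemma covector01_scaleR: "covector01 g J (a *\<^sub>R v) = (\<lambda>w. complex_of_real a * covector01 g J v w)"
  by (simp add: fun_eq_iff covector01_def algebra_simps)

lemma vec_act_eq: "vec_act g J v s = (\<lambda>x. ext_mult (covector01 g J v) s x - contraction v s x)"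
  by (simp add: fun_eq_iff vec_act_def)

lemma vec_act_antiforms: "s \<in> antiforms J \<Longrightarrow> vec_act g J v s \<in> antiforms J"
  unfolding vec_act_eq
  by (intro antiforms_diff antiforms_ext_mult antiforms_contraction antilinear_covector01)

text \<open>With \<open>\<theta>\<close> the covector of \<open>v\<close> and \<open>\<iota>\<close>
  the contraction, both squares vanish. The mixed terms of the square of
  \<open>\<theta> - \<iota>\<close> are minus the anticommutator, which by the Leibniz rule is
  multiplication by \<open>\<theta> v = g v v\<close>.\<close>

lemma vec_act_square:
  assumes "s \<in> antiforms J"
  shows "vec_act g J v (vec_act g J v s) = (\<lambda>x. - complex_of_real (g v v) * s x)"
  using assms
  by (simp add: vec_act_eq fun_eq_iff ext_mult_diff contraction_diff ext_mult_square
      contraction_ext_mult contraction_twice covector01_self)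

lemma vec_act_plus_vec:
  assumes "s \<in> antiforms J"
  shows "vec_act g J (v + w) s = (\<lambda>x. vec_act g J v s x + vec_act g J w s x)"
  by (simp add: vec_act_eq fun_eq_iff ext_mult_covector01_plus contraction_plus_vec[OF assms])

lemma vec_act_scaleR_vec:
  assumes "s \<in> antiforms J"
  shows "vec_act g J (a *\<^sub>R v) s = (\<lambda>x. complex_of_real a * vec_act g J v s x)"
  by (simp add: vec_act_eq fun_eq_iff covector01_scaleR ext_mult_scale_covector
      contraction_scaleR_vec[OF assms] algebra_simps)

text \<open>For a unit vector \<open>v\<close> this is \<open>1 - 2 N\<close>, where
  \<open>N\<close> is the number operator of the mode \<open>v\<close>.\<close>

definition number_diff :: "'e \<Rightarrow> ('e list \<Rightarrow> complex) \<Rightarrow> 'e list \<Rightarrow> complex" where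
  "number_diff v s x =
     contraction v (ext_mult (covector01 g J v) s) x - ext_mult (covector01 g J v) (contraction v s) x"

lemma number_diff_eq: "number_diff v s =
    (\<lambda>x. contraction v (ext_mult (covector01 g J v) s) x - ext_mult (covector01 g J v) (contraction v s) x)"
  by (simp add: fun_eq_iff number_diff_def)

text \<open>Exterior multiplication is complex linear in the vector while contraction is conjugate
  linear; together with the minus sign in \<open>vec_act\<close> both terms acquire the factor
  \<open>\<i>\<close>.\<close>

lemma vec_act_J:
  assumes "s \<in> antiforms J"
  shows "vec_act g J (J v) s =
     (\<lambda>x. \<i> * ext_mult (covector01 g J v) s x + \<i> * contraction v s x)"
  by (simp add: vec_act_eq fun_eq_iff covector01_J ext_mult_scale_covector contraction_J[OF assms])

lemma vec_act_vec_act_J: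
  assumes "s \<in> antiforms J"
  shows "vec_act g J v (vec_act g J (J v) s) = (\<lambda>x. - \<i> * number_diff v s x)"
  unfolding vec_act_J[OF assms]
  by (simp add: vec_act_eq fun_eq_iff number_diff_def ext_mult_add contraction_add
      ext_mult_scale contraction_scale ext_mult_square contraction_twice[OF assms] algebra_simps)

lemma vec_act_J_vec_act:
  assumes "s \<in> antiforms J"
  shows "vec_act g J (J v) (vec_act g J v s) = (\<lambda>x. \<i> * number_diff v s x)"
  unfolding vec_act_J[OF vec_act_antiforms[OF assms]]
  by (simp add: vec_act_eq fun_eq_iff number_diff_def ext_mult_diff contraction_diff
      ext_mult_square contraction_twice[OF assms] algebra_simps)

end

section \<open>The Fock space of a unitary frame\<close>

locale unitary_frame = hermitian_space n g J for n g and J :: "'b::euclidean_space \<Rightarrow> 'b" +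
  fixes e :: "nat \<Rightarrow> 'b"
  assumes frame: "unitary_basis n g J e"
begin

text \<open>The span of the exterior monomials in the first \<open>j\<close> covectors. It is cut
  out by the annihilators of the other modes, so that no monomials, index sets or orderings have to
  be named.\<close>

definition fock :: "nat \<Rightarrow> ('b list \<Rightarrow> complex) set" where
  "fock j = {s \<in> antiforms J. \<forall>k. j \<le> k \<and> k < n \<longrightarrow> contraction (e k) s = (\<lambda>x. 0)}"

abbreviation create :: "nat \<Rightarrow> ('b list \<Rightarrow> complex) \<Rightarrow> 'b list \<Rightarrow> complex" where
  "create k \<equiv> ext_mult (covector01 g J (e k))"

abbreviation annihilate :: "nat \<Rightarrow> ('b list \<Rightarrow> complex) \<Rightarrow> 'b list \<Rightarrow> complex" where
  "annihilate k \<equiv> contraction (e k)"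

text \<open>The canonical anticommutation relations: in a unitary frame
  \<open>g (e j) (J (e k))\<close> vanishes, so the covector of \<open>e j\<close> takes the real
  value 0 or 1 at \<open>e k\<close>.\<close>

lemma annihilate_create:
  assumes "j < n" "k < n"
  shows "annihilate k (create j s) = (\<lambda>x. (if j = k then s x else 0) - create j (annihilate k s) x)"
  using assms frame by (simp add: contraction_ext_mult covector01_def unitary_basis_def fun_eq_iff)

lemma antiforms_create: "s \<in> antiforms J \<Longrightarrow> create k s \<in> antiforms J"
  by (intro antiforms_ext_mult antilinear_covector01)

lemma fock_combination_closed: "combination_closed (fock j)"
  unfolding combination_closed_def
proof (intro allI impI)
  fix m :: nat and a s assume s: "\<forall>i<m. s i \<in> fock j"
  then have "annihilate k (\<lambda>x. \<Sum>i<m. a i * s i x) = (\<lambda>x. 0)" if "j \<le> k" "k < n" for k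
    using that by (simp add: fock_def contraction_sum)
  moreover have "(\<lambda>x. \<Sum>i<m. a i * s i x) \<in> antiforms J"
    using s by (intro antiforms_sum) (auto simp: fock_def)
  ultimately show "(\<lambda>x. \<Sum>i<m. a i * s i x) \<in> fock j"
    by (simp add: fock_def)
qed

lemma fock_mono: "s \<in> fock j \<Longrightarrow> s \<in> fock (Suc j)"
  by (simp add: fock_def)

lemma fock_create:
  assumes "j < n" "s \<in> fock j"
  shows "create j s \<in> fock (Suc j)"
  using assms by (auto simp: fock_def antiforms_create annihilate_create ext_mult_zero)

lemma fock_annihilate:
  assumes "j < n" "s \<in> fock (Suc j)"
  shows "annihilate j s \<in> fock j"
  unfolding fock_def
proof (intro CollectI conjI allI impI)
  have s: "s \<in> antiforms J" using assms by (simp add: fock_def)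
  then show "annihilate j s \<in> antiforms J" by (rule antiforms_contraction)
  fix k assume k: "j \<le> k \<and> k < n"
  show "annihilate k (annihilate j s) = (\<lambda>x. 0)"
  proof (cases "k = j")
    case True
    then show ?thesis using contraction_twice[OF s] by simp
  next
    case False
    then have "annihilate k s = (\<lambda>x. 0)" using assms k by (simp add: fock_def)
    then show ?thesis
      using contraction_anticommute[OF s, of "e k" "e j"] by (simp add: contraction_zero)
  qed
qed

text \<open>The anticommutator of mode \<open>j\<close> with itself is the identity, which
  decomposes \<open>s\<close> into a part with mode \<open>j\<close> empty and a part with it
  occupied.\<close>

lemma fock_split:
  assumes "j < n" "s \<in> fock (Suc j)"
  shows "\<exists>u\<in>fock j. \<exists>w\<in>fock j. s = (\<lambda>x. u x + create j w x)"
proof (intro bexI)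
  show "annihilate j s \<in> fock j" by (rule fock_annihilate[OF assms])
  have "create j s \<in> antiforms J"
    using assms by (intro antiforms_create) (simp add: fock_def)
  moreover have "annihilate k (annihilate j (create j s)) = (\<lambda>x. 0)" if k: "j \<le> k" "k < n" for k
  proof (cases "k = j")
    case True
    then show ?thesis using contraction_twice[OF \<open>create j s \<in> antiforms J\<close>] by simp
  next
    case False
    then have "annihilate k (create j s) = (\<lambda>x. 0)"
      using assms k by (simp add: fock_def annihilate_create ext_mult_zero)
    then show ?thesis
      using contraction_anticommute[OF \<open>create j s \<in> antiforms J\<close>, of "e k" "e j"]
      by (simp add: contraction_zero)
  qed
  ultimately show "annihilate j (create j s) \<in> fock j"
    by (simp add: fock_def antiforms_contraction)
  show "s = (\<lambda>x. annihilate j (create j s) x + create j (annihilate j s) x)"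
    using assms by (simp add: annihilate_create)
qed

text \<open>Contraction by \<open>J (e k)\<close> is a multiple of contraction by
  \<open>e k\<close>, so all contractions vanish on a real spanning set and hence everywhere. Such a
  form is a multiple of the vacuum.\<close>

lemma antiforms_annihilated:
  assumes s: "s \<in> antiforms J" and "\<And>k. k < n \<Longrightarrow> annihilate k s = (\<lambda>x. 0)"
  shows "s = (\<lambda>x. s [] * (if x = [] then 1 else 0))"
proof -
  have "contraction v s = (\<lambda>x. 0)" for v
  proof -
    have "v \<in> span (e ` {..<n} \<union> (\<lambda>k. J (e k)) ` {..<n})"
      using frame by (simp add: unitary_basis_def)
    then show ?thesis
    proof (induction rule: span_induct_alt)
      case base
      then show ?case
        using contraction_scaleR_vec[OF s, of 0 0] by simp
    next
      case (step c v w)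
      then have "contraction v s = (\<lambda>x. 0)"
        using assms(2) contraction_J[OF s] by auto
      then show ?case
        using step by (simp add: contraction_plus_vec[OF s] contraction_scaleR_vec[OF s])
    qed
  qed
  then have "s (v # x) = 0" for v x
    by (simp add: contraction_def fun_eq_iff)
  then show ?thesis
    by (auto simp: fun_eq_iff neq_Nil_conv)
qed

lemma fock_0_basis: "complex_basis (fock 0) 1 (\<lambda>i x. if x = [] then 1 else 0)"
proof (rule complex_basisI)
  show "(\<lambda>x. if x = [] then 1 else 0) \<in> fock 0"
    using antiforms_vacuum by (simp add: fock_def contraction_def fun_eq_iff)
  show "\<exists>a. s = (\<lambda>x. \<Sum>i<(1::nat). a i * (if x = [] then 1 else 0))" if "s \<in> fock 0" for s
  proof
    have "s = (\<lambda>x. s [] * (if x = [] then 1 else 0))"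
      using that by (intro antiforms_annihilated) (auto simp: fock_def)
    also have "\<dots> = (\<lambda>x. \<Sum>i<(1::nat). s [] * (if x = [] then 1 else 0))" by simp
    finally show "s = (\<lambda>x. \<Sum>i<(1::nat). s [] * (if x = [] then 1 else 0))" .
  qed
  show "a i = 0" if eq: "(\<lambda>x. \<Sum>i<(1::nat). a i * (if x = [] then 1 else 0)) = (\<lambda>x::'b list. 0)" and i: "i < 1"
    for a :: "nat \<Rightarrow> complex" and i
    using fun_cong[OF eq, of "[]"] i by simp
qed

lemma number_diff_fock:
  assumes "j \<le> k" "k < n" "s \<in> fock j"
  shows "number_diff (e k) s = s"
proof -
  have "annihilate k s = (\<lambda>x. 0)" using assms by (simp add: fock_def)
  then show ?thesis using assms
    by (simp add: number_diff_eq annihilate_create ext_mult_zero)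
qed

text \<open>For distinct modes the creator anticommutes with both factors of each product and so
  commutes with the products. For the same mode the state is occupied, and the eigenvalue is
  -1.\<close>

lemma number_diff_create:
  assumes "j < n" "k < n" "s \<in> antiforms J"
  shows "number_diff (e k) (create j s) =
    (if j = k then (\<lambda>x. - create j s x) else create j (number_diff (e k) s))"
proof (cases "j = k")
  case True
  then show ?thesis using assms
    by (simp add: fun_eq_iff number_diff_def annihilate_create ext_mult_square contraction_zero
        ext_mult_diff)
next
  case False
  have "annihilate k (create k (create j s)) = annihilate k (\<lambda>x. - 1 * create j (create k s) x)"
    using ext_mult_anticommute[of "covector01 g J (e k)" "covector01 g J (e j)" s]
    by (intro arg_cong[of _ _ "annihilate k"]) (simp add: fun_eq_iff)
  also have "\<dots> = (\<lambda>x. create j (annihilate k (create k s)) x)"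
    using False assms unfolding contraction_scale annihilate_create[OF assms(1,2), of "create k s"]
    by simp
  finally have 1: "annihilate k (create k (create j s)) = create j (annihilate k (create k s))" by simp
  have "create k (annihilate k (create j s)) = create k (\<lambda>x. - 1 * create j (annihilate k s) x)"
    using False assms by (simp add: annihilate_create)
  also have "\<dots> = create j (create k (annihilate k s))"
    unfolding ext_mult_scale
    using ext_mult_anticommute[of "covector01 g J (e k)" "covector01 g J (e j)" "annihilate k s"]
    by (simp add: fun_eq_iff)
  finally have 2: "create k (annihilate k (create j s)) = create j (create k (annihilate k s))" .
  show ?thesis
    using False by (simp add: number_diff_eq 1 2 ext_mult_diff)
qed

lemma fock_Suc_basis:
  assumes j: "j < n" and b: "complex_basis (fock j) m b"
  shows "complex_basis (fock (Suc j)) (m + m) (\<lambda>i. if i < m then b i else create j (b (i - m)))"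
    (is "complex_basis _ _ ?b")
proof -
  have sum_b: "(\<lambda>x. \<Sum>i<m + m. a i * ?b i x) =
      (\<lambda>x. (\<Sum>i<m. a i * b i x) + create j (\<lambda>x. \<Sum>i<m. a (m + i) * b i x) x)" for a
    by (simp add: sum_lessThan_add ext_mult_sum)
  have comb: "(\<lambda>x. \<Sum>i<m. a i * b i x) \<in> fock j" for a
    by (intro combination_closedD fock_combination_closed complex_basis_in[OF b])
  show ?thesis
  proof (rule complex_basisI)
    show "?b i \<in> fock (Suc j)" if "i < m + m" for i
      using that complex_basis_in[OF b] fock_mono fock_create[OF j] by auto
  next
    fix s assume "s \<in> fock (Suc j)"
    then obtain u w where uw: "u \<in> fock j" "w \<in> fock j" "s = (\<lambda>x. u x + create j w x)"
      using fock_split[OF j] by blast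
    obtain a where a: "u = (\<lambda>x. \<Sum>i<m. a i * b i x)"
      using complex_basis_span[OF b uw(1)] by blast
    obtain c where c: "w = (\<lambda>x. \<Sum>i<m. c i * b i x)"
      using complex_basis_span[OF b uw(2)] by blast
    have "s = (\<lambda>x. \<Sum>i<m + m. (if i < m then a i else c (i - m)) * ?b i x)"
      unfolding sum_b uw(3) by (simp add: a c)
    then show "\<exists>a. s = (\<lambda>x. \<Sum>i<m + m. a i * ?b i x)"
      by (intro exI[of _ "\<lambda>i. if i < m then a i else c (i - m)"])
  next
    fix a :: "nat \<Rightarrow> complex" and i
    assume eq: "(\<lambda>x. \<Sum>i<m + m. a i * ?b i x) = (\<lambda>x. 0)" and i: "i < m + m"
    define u where "u = (\<lambda>x. \<Sum>i<m. a i * b i x)"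
    define w where "w = (\<lambda>x. \<Sum>i<m. a (m + i) * b i x)"
    have u: "u \<in> fock j" and w: "w \<in> fock j" unfolding u_def w_def by (rule comb)+
    have uw: "(\<lambda>x. u x + create j w x) = (\<lambda>x. 0)"
      using eq unfolding sum_b u_def w_def .
    \<comment> \<open>Annihilating mode \<open>j\<close> removes the empty half of the relation and
      turns the occupied half into \<open>w\<close>, so the two halves vanish separately.\<close>
    have "annihilate j (\<lambda>x. u x + create j w x) = w"
      using u w j by (simp add: contraction_add annihilate_create fock_def ext_mult_zero)
    then have w0: "w = (\<lambda>x. 0)" unfolding uw contraction_zero by simp
    have u0: "u = (\<lambda>x. 0)" using uw unfolding w0 ext_mult_zero by simp
    have zero: "c i = 0" if "(\<lambda>x. \<Sum>i<m. c i * b i x) = (\<lambda>x. 0)" "i < m" for c i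
    proof -
      have "(\<lambda>x. \<Sum>i<m. c i * b i x) = (\<lambda>x. \<Sum>i<m. 0 * b i x)"
        using that(1) by simp
      from complex_basis_unique[OF b fock_combination_closed this that(2)]
      show ?thesis .
    qed
    show "a i = 0"
    proof (cases "i < m")
      case True
      show ?thesis by (rule zero[OF u0[unfolded u_def] True])
    next
      case False
      then have "a (m + (i - m)) = 0"
        using zero[OF w0[unfolded w_def], of "i - m"] i by simp
      then show ?thesis using False by simp
    qed
  qed
qed

text \<open>Only the product of the shifted eigenvalues is tracked, which avoids a bijection between
  basis indices and sign choices. It is stated for all \<open>\<mu>\<close> because the induction
  step uses it at \<open>\<mu> + l j\<close> and at \<open>\<mu> - l j\<close>.\<close>

lemma fock_eigenbasis:
  fixes l :: "nat \<Rightarrow> real"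
  assumes "j \<le> n"
  shows "\<exists>b ev. complex_basis (fock j) (2 ^ j) b \<and>
    (\<forall>i<2 ^ j. \<forall>x. (\<Sum>k<j. complex_of_real (l k) * number_diff (e k) (b i) x) =
       complex_of_real (ev i) * b i x) \<and>
    (\<forall>\<mu>. (\<Prod>i<2 ^ j. \<mu> + ev i) = (\<Prod>s\<in>{..<j} \<rightarrow>\<^sub>E {-1, 1}. \<mu> + (\<Sum>k<j. s k * l k)))"
  using assms
proof (induction j)
  case 0
  show ?case
    by (rule exI[of _ "\<lambda>i x. if x = [] then 1 else 0"], rule exI[of _ "\<lambda>i. 0"])
      (use fock_0_basis in simp)
next
  case (Suc j)
  obtain b ev where b: "complex_basis (fock j) (2 ^ j) b"
    and eig: "\<And>i x. i < 2 ^ j \<Longrightarrow> (\<Sum>k<j. complex_of_real (l k) * number_diff (e k) (b i) x) =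
       complex_of_real (ev i) * b i x"
    and pr: "\<And>\<mu>. (\<Prod>i<2 ^ j. \<mu> + ev i) = (\<Prod>s\<in>{..<j} \<rightarrow>\<^sub>E {-1, 1}. \<mu> + (\<Sum>k<j. s k * l k))"
    using Suc.IH[OF Suc_leD[OF Suc.prems]] by blast
  have j: "j < n" using Suc.prems by simp
  let ?m = "2 ^ j :: nat"
  let ?b = "\<lambda>i. if i < ?m then b i else create j (b (i - ?m))"
  let ?ev = "\<lambda>i. if i < ?m then ev i + l j else ev (i - ?m) - l j"
  have "complex_basis (fock (Suc j)) (2 ^ Suc j) ?b"
    using fock_Suc_basis[OF j b] by (simp add: mult_2)
  moreover have "(\<Sum>k<Suc j. complex_of_real (l k) * number_diff (e k) (?b i) x) =
      complex_of_real (?ev i) * ?b i x" if i: "i < 2 ^ Suc j" for i x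
  proof (cases "i < ?m")
    case True
    then show ?thesis
      using number_diff_fock[OF order_refl j complex_basis_in[OF b True]] eig[OF True]
      by (simp add: algebra_simps)
  next
    case False
    then have i': "i - ?m < ?m" using i by simp
    have a: "b (i - ?m) \<in> antiforms J"
      using complex_basis_in[OF b i'] by (simp add: fock_def)
    have "(\<Sum>k<j. complex_of_real (l k) * number_diff (e k) (create j (b (i - ?m))) x) =
        (\<Sum>k<j. complex_of_real (l k) * create j (number_diff (e k) (b (i - ?m))) x)"
      using j by (intro sum.cong) (simp_all add: number_diff_create a)
    also have "\<dots> = create j (\<lambda>x. \<Sum>k<j. complex_of_real (l k) * number_diff (e k) (b (i - ?m)) x) x"
      by (simp add: ext_mult_sum)
    also have "\<dots> = complex_of_real (ev (i - ?m)) * create j (b (i - ?m)) x"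
      by (simp add: eig[OF i'] ext_mult_scale)
    finally show ?thesis
      using False j by (simp add: number_diff_create a algebra_simps)
  qed
  moreover have "(\<Prod>i<2 ^ Suc j. \<mu> + ?ev i) =
      (\<Prod>s\<in>{..<Suc j} \<rightarrow>\<^sub>E {-1, 1}. \<mu> + (\<Sum>k<Suc j. s k * l k))" for \<mu>
  proof -
    have "(\<Prod>i<2 ^ Suc j. \<mu> + ?ev i) = (\<Prod>i<?m. \<mu> + (ev i + l j)) * (\<Prod>i<?m. \<mu> + (ev i - l j))"
      by (simp add: mult_2 prod_lessThan_add)
    also have "\<dots> = (\<Prod>i<?m. (\<mu> + l j) + ev i) * (\<Prod>i<?m. (\<mu> - l j) + ev i)"
      by (intro arg_cong2[where f="(*)"] prod.cong) auto
    finally show ?thesis unfolding pr prod_signs_Suc .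
  qed
  ultimately show ?case
    by (intro exI[of _ ?b] exI[of _ ?ev] conjI allI impI)
qed

text \<open>Each creator raises the degree by one, and at most \<open>j\<close> modes are
  available.\<close>

lemma fock_degree: "j \<le> n \<Longrightarrow> s \<in> fock j \<Longrightarrow> j < length x \<Longrightarrow> s x = 0"
proof (induction j arbitrary: s x)
  case 0
  then have "s x = s [] * (if x = [] then 1 else 0)"
    by (intro fun_cong[OF antiforms_annihilated]) (auto simp: fock_def)
  then show ?case using 0 by simp
next
  case (Suc j)
  then have "j < n" by simp
  then obtain u w where uw: "u \<in> fock j" "w \<in> fock j" "s = (\<lambda>x. u x + create j w x)"
    using fock_split Suc.prems by blast
  have "w (take i x @ drop (Suc i) x) = 0" if "i < length x" for i
    using Suc.IH[of w "take i x @ drop (Suc i) x"] uw Suc.prems that by simp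
  then show ?case
    using Suc.IH[of u x] uw Suc.prems by (simp add: ext_mult_def)
qed

lemma fock_n: "fock n = antiforms J"
  by (auto simp: fock_def)

lemma spinors_eq_antiforms: "spinors n J = antiforms J"
proof (intro equalityI subsetI)
  fix s assume "s \<in> spinors n J"
  then obtain \<alpha> where \<alpha>: "s = (\<lambda>x. \<Sum>q\<le>n. \<alpha> q x)" "\<And>q. q \<le> n \<Longrightarrow> \<alpha> q \<in> forms0 J q"
    by (auto simp: spinors_def)
  have "\<alpha> q \<in> antiforms J" if "q \<le> n" for q
  proof -
    have "linear (\<lambda>v. \<alpha> q (x @ v # y))" for x y
    proof (cases "length x + length y + 1 = q")
      case True
      then show ?thesis using \<alpha>(2)[OF that] by (simp add: forms0_def)
    next
      case False
      then have "(\<lambda>v. \<alpha> q (x @ v # y)) = (\<lambda>v. 0)"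
        using \<alpha>(2)[OF that] by (auto simp: forms0_def)
      then show ?thesis by (simp add: linear_zero)
    qed
    then show ?thesis
      using \<alpha>(2)[OF that] by (simp add: forms0_def antiforms_def)
  qed
  then show "s \<in> antiforms J"
    using antiforms_sum[of "{..n}" \<alpha> J "\<lambda>_. 1"] \<alpha>(1) by simp
next
  fix s assume s: "s \<in> antiforms J"
  \<comment> \<open>The homogeneous components of \<open>s\<close>; those of degree above
    \<open>n\<close> vanish by \<open>fock_degree\<close>.\<close>
  define \<alpha> where "\<alpha> q x = (if length x = q then s x else 0)" for q x
  have "s = (\<lambda>x. \<Sum>q\<le>n. \<alpha> q x)"
    using fock_degree[of n s] s by (auto simp: fun_eq_iff \<alpha>_def fock_n)
  moreover have "\<alpha> q \<in> forms0 J q" for q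
    using s by (auto simp: forms0_def antiforms_def \<alpha>_def)
  ultimately show "s \<in> spinors n J" by (auto simp: spinors_def)
qed

lemma antiforms_combination_closed: "combination_closed (antiforms J)"
  using fock_combination_closed[of n] by (simp add: fock_n)

lemma endo_det_spinors:
  assumes T: "\<And>s. s \<in> antiforms J \<Longrightarrow>
      T s = (\<lambda>x. complex_of_real \<mu> * s x + (\<Sum>k<n. complex_of_real (l k) * number_diff (e k) s x))"
  shows "endo_det (spinors n J) T =
    complex_of_real (\<Prod>s\<in>{..<n} \<rightarrow>\<^sub>E {-1, 1}. \<mu> + (\<Sum>k<n. s k * l k))"
proof -
  obtain b ev where b: "complex_basis (antiforms J) (2 ^ n) b"
    and eig: "\<And>i x. i < 2 ^ n \<Longrightarrow> (\<Sum>k<n. complex_of_real (l k) * number_diff (e k) (b i) x) =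
       complex_of_real (ev i) * b i x"
    and pr: "\<And>\<mu>. (\<Prod>i<2 ^ n. \<mu> + ev i) = (\<Prod>s\<in>{..<n} \<rightarrow>\<^sub>E {-1, 1}. \<mu> + (\<Sum>k<n. s k * l k))"
    using fock_eigenbasis[of n l] unfolding fock_n by blast
  have nd: "number_diff v (\<lambda>x. \<Sum>i<m. a i * s i x) = (\<lambda>x. \<Sum>i<m. a i * number_diff v (s i) x)"
    for v a s and m :: nat
    by (simp add: fun_eq_iff number_diff_def contraction_sum ext_mult_sum sum_subtractf algebra_simps)
  have "preserves_combinations (antiforms J) T"
    unfolding preserves_combinations_def
  proof (intro allI impI)
    fix m :: nat and a s assume s: "\<forall>i<m. s i \<in> antiforms J"
    then have *: "(\<lambda>x. \<Sum>i<m. a i * s i x) \<in> antiforms J"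
      by (intro antiforms_sum) auto
    have "(\<Sum>i<m. a i * T (s i) x) = (\<Sum>i<m. a i * (complex_of_real \<mu> * s i x +
        (\<Sum>k<n. complex_of_real (l k) * number_diff (e k) (s i) x)))" for x
      using s by (intro sum.cong) (auto simp: T)
    then show "T (\<lambda>x. \<Sum>i<m. a i * s i x) = (\<lambda>x. \<Sum>i<m. a i * T (s i) x)"
      by (simp add: T[OF *] nd fun_eq_iff sum_distrib_left sum.distrib algebra_simps sum.swap[of _ "{..<n}" "{..<m}"])
  qed
  moreover have "T (b i) = (\<lambda>x. complex_of_real (\<mu> + ev i) * b i x)" if "i < 2 ^ n" for i
    using T[OF complex_basis_in[OF b that]] eig[OF that] by (simp add: fun_eq_iff algebra_simps)
  ultimately have "endo_det (antiforms J) T = (\<Prod>i<2 ^ n. complex_of_real (\<mu> + ev i))"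
    by (intro endo_det_diagonal[OF b antiforms_combination_closed])
  then show ?thesis
    unfolding spinors_eq_antiforms by (simp flip: pr)
qed

end

section \<open>The complexified Clifford algebra\<close>

definition conv :: "('v list \<Rightarrow> complex) \<Rightarrow> ('v list \<Rightarrow> complex) \<Rightarrow> 'v list \<Rightarrow> complex" where
  "conv f h w = (\<Sum>k\<le>length w. f (take k w) * h (drop k w))"

lemma free_alg_simps:
  "carrier free_alg = {f. finite {w. f w \<noteq> 0}}"
  "f \<otimes>\<^bsub>free_alg\<^esub> h = conv f h"
  "\<one>\<^bsub>free_alg\<^esub> = word []"
  "\<zero>\<^bsub>free_alg\<^esub> = (\<lambda>w. 0)"
  "f \<oplus>\<^bsub>free_alg\<^esub> h = (\<lambda>w. f w + h w)"
  by (simp_all add: free_alg_def conv_def word_def fun_eq_iff)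

lemma conv_Nil [simp]: "conv f h [] = f [] * h []"
  by (simp add: conv_def)

text \<open>A cut of \<open>a # w\<close> lies before \<open>a\<close> or is a cut of
  \<open>w\<close>. This recursion drives the inductions on words.\<close>

lemma conv_Cons: "conv f h (a # w) = f [] * h (a # w) + conv (\<lambda>w. f (a # w)) h w"
  by (simp add: conv_def sum.atMost_Suc_shift del: sum.atMost_Suc)

lemma conv_add_left: "conv (\<lambda>w. f w + f' w) h w = conv f h w + conv f' h w"
  by (simp add: conv_def algebra_simps sum.distrib)

lemma conv_add_right: "conv f (\<lambda>w. h w + h' w) w = conv f h w + conv f h' w"
  by (simp add: conv_def algebra_simps sum.distrib)

lemma conv_scale_left: "conv (\<lambda>w. c * f w) h w = c * conv f h w"
  by (simp add: conv_def sum_distrib_left algebra_simps)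

lemma conv_sum_left: "conv (\<lambda>w. \<Sum>i\<in>I. c i * f i w) h = (\<lambda>w. \<Sum>i\<in>I. c i * conv (f i) h w)"
  unfolding conv_def fun_eq_iff sum_distrib_left sum_distrib_right
  by (auto simp: mult.assoc intro: sum.swap)

lemma conv_sum_right: "conv f (\<lambda>w. \<Sum>i\<in>I. c i * h i w) = (\<lambda>w. \<Sum>i\<in>I. c i * conv f (h i) w)"
  unfolding conv_def fun_eq_iff sum_distrib_left
  by (auto simp: mult_ac intro: sum.swap)

lemma conv_assoc: "conv (conv f h) p w = conv f (conv h p) w"
  by (induction w arbitrary: f)
    (simp_all add: conv_Cons conv_add_left conv_scale_left algebra_simps)

lemma conv_word_Nil_left: "conv (word []) f w = f w"
proof (cases w)
  case (Cons a w')
  then show ?thesis by (simp add: conv_Cons word_def) (simp add: conv_def)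
qed (simp add: word_def)

lemma conv_word_Nil_right: "conv f (word []) w = f w"
  by (induction w arbitrary: f) (simp_all add: conv_Cons, simp_all add: word_def)

lemma conv_word_word: "conv (word u) (word v) = word (u @ v)"
proof
  fix w show "conv (word u) (word v) w = word (u @ v) w"
  proof (induction u arbitrary: w)
    case Nil
    show ?case by (simp add: conv_word_Nil_left)
  next
    case (Cons a u)
    show ?case
    proof (cases w)
      case (Cons b w')
      have *: "(\<lambda>w. word (a # u) (b # w)) = (\<lambda>w. (if b = a then 1 else 0) * word u w)"
        by (auto simp: word_def)
      show ?thesis
        unfolding Cons conv_Cons * conv_scale_left Cons.IH by (simp add: word_def)
    qed (simp add: word_def)
  qed
qed

lemma conv_support: "{w. conv f h w \<noteq> 0} \<subseteq> (\<lambda>(u, v). u @ v) ` ({w. f w \<noteq> 0} \<times> {w. h w \<noteq> 0})"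
proof
  fix w assume "w \<in> {w. conv f h w \<noteq> 0}"
  then obtain k where "f (take k w) * h (drop k w) \<noteq> 0"
    unfolding conv_def by (auto elim: sum.not_neutral_contains_not_neutral)
  then show "w \<in> (\<lambda>(u, v). u @ v) ` ({w. f w \<noteq> 0} \<times> {w. h w \<noteq> 0})"
    by (intro image_eqI[of _ _ "(take k w, drop k w)"]) auto
qed

lemma conv_finite_support:
  "finite {w. f w \<noteq> 0} \<Longrightarrow> finite {w. h w \<noteq> 0} \<Longrightarrow> finite {w. conv f h w \<noteq> 0}"
  by (rule finite_subset[OF conv_support]) simp

lemma add_finite_support:
  fixes f h :: "'v list \<Rightarrow> complex"
  shows "finite {w. f w \<noteq> 0} \<Longrightarrow> finite {w. h w \<noteq> 0} \<Longrightarrow> finite {w. f w + h w \<noteq> 0}"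
  by (rule finite_subset[of _ "{w. f w \<noteq> 0} \<union> {w. h w \<noteq> 0}"]) auto

lemma scale_finite_support:
  fixes f :: "'v list \<Rightarrow> complex"
  shows "finite {w. f w \<noteq> 0} \<Longrightarrow> finite {w. c * f w \<noteq> 0}"
  by (rule finite_subset[of _ "{w. f w \<noteq> 0}"]) auto

lemma word_finite_support: "finite {w. word x w \<noteq> 0}"
  by (simp add: word_def)

lemma ring_free_alg: "ring (free_alg :: ('v list \<Rightarrow> complex) ring)"
proof (rule ringI)
  show "abelian_group (free_alg :: ('v list \<Rightarrow> complex) ring)"
  proof (rule abelian_groupI)
    fix f :: "'v list \<Rightarrow> complex" assume "f \<in> carrier free_alg"
    then show "\<exists>h\<in>carrier free_alg. h \<oplus>\<^bsub>free_alg\<^esub> f = \<zero>\<^bsub>free_alg\<^esub>"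
      by (intro bexI[of _ "\<lambda>w. - f w"]) (simp_all add: free_alg_simps)
  qed (auto simp: free_alg_simps add_finite_support algebra_simps)
  show "Group.monoid (free_alg :: ('v list \<Rightarrow> complex) ring)"
    by (rule monoidI)
      (auto simp: free_alg_simps conv_finite_support word_finite_support conv_assoc
        conv_word_Nil_left conv_word_Nil_right fun_eq_iff)
qed (auto simp: free_alg_simps conv_add_left conv_add_right fun_eq_iff)

interpretation free_alg: ring "free_alg :: ('v list \<Rightarrow> complex) ring"
  by (rule ring_free_alg)

lemma free_alg_carrier_add:
  "f \<in> carrier free_alg \<Longrightarrow> h \<in> carrier free_alg \<Longrightarrow> (\<lambda>w. f w + h w) \<in> carrier free_alg"
  by (simp add: free_alg_simps add_finite_support)

lemma free_alg_carrier_scale: "f \<in> carrier free_alg \<Longrightarrow> (\<lambda>w. c * f w) \<in> carrier free_alg"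
  by (simp only: free_alg_simps mem_Collect_eq scale_finite_support)

lemma free_alg_carrier_diff:
  "f \<in> carrier free_alg \<Longrightarrow> h \<in> carrier free_alg \<Longrightarrow> (\<lambda>w. f w - h w) \<in> carrier free_alg"
  using free_alg_carrier_add[of f "\<lambda>w. -1 * h w"] free_alg_carrier_scale[of h "-1"] by simp

lemma free_alg_carrier_word: "word x \<in> carrier free_alg"
  by (simp add: free_alg_simps word_finite_support)

lemma free_alg_carrier_sum:
  "(\<And>i. i \<in> I \<Longrightarrow> f i \<in> carrier free_alg) \<Longrightarrow> (\<lambda>w. \<Sum>i\<in>I. c i * f i w) \<in> carrier free_alg"
proof (induction I rule: infinite_finite_induct)
  case (insert i I)
  then show ?case
    by (simp add: free_alg_carrier_add free_alg_carrier_scale)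
qed (simp_all add: free_alg_simps)

lemma free_alg_neg:
  assumes "f \<in> carrier free_alg"
  shows "\<ominus>\<^bsub>free_alg\<^esub> f = (\<lambda>w. - f w)"
  using free_alg_carrier_scale[OF assms, of "-1"] assms
  by (intro free_alg.minus_equality) (simp_all add: free_alg_simps)

lemma free_alg_diff:
  assumes "f \<in> carrier free_alg" "h \<in> carrier free_alg"
  shows "f \<ominus>\<^bsub>free_alg\<^esub> h = (\<lambda>w. f w - h w)"
  using assms by (simp add: a_minus_def free_alg_neg free_alg_simps)

section \<open>The Clifford ideal and its quotient ring\<close>

lemma clifford_relations_carrier: "clifford_relations g \<subseteq> carrier free_alg"
  unfolding clifford_relations_def
  by (auto intro!: free_alg_carrier_diff free_alg_carrier_add free_alg_carrier_scale free_alg_carrier_word)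

lemma ideal_clifford_ideal: "ideal (clifford_ideal g) free_alg"
  unfolding clifford_ideal_def
  by (rule free_alg.genideal_ideal[OF clifford_relations_carrier])

lemma clifford_relation_in_ideal: "r \<in> clifford_relations g \<Longrightarrow> r \<in> clifford_ideal g"
  using free_alg.genideal_self[OF clifford_relations_carrier] unfolding clifford_ideal_def by blast

text \<open>An ideal is closed under ring multiplication, and scaling by \<open>c\<close> is
  multiplication by \<open>c\<close> times the unit; so the ideal is a complex subspace.\<close>

lemma clifford_ideal_scale:
  assumes "f \<in> clifford_ideal g"
  shows "(\<lambda>w. c * f w) \<in> clifford_ideal g"
proof -
  have "(\<lambda>w. c * word [] w) \<otimes>\<^bsub>free_alg\<^esub> f \<in> clifford_ideal g"
    by (intro ideal.I_l_closed[OF ideal_clifford_ideal] assms free_alg_carrier_scale free_alg_carrier_word)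
  moreover have "(\<lambda>w. c * word [] w) \<otimes>\<^bsub>free_alg\<^esub> f = (\<lambda>w. c * f w)"
    by (simp add: fun_eq_iff free_alg_simps conv_scale_left conv_word_Nil_left)
  ultimately show ?thesis by simp
qed

lemma clifford_ideal_add:
  "f \<in> clifford_ideal g \<Longrightarrow> h \<in> clifford_ideal g \<Longrightarrow> (\<lambda>w. f w + h w) \<in> clifford_ideal g"
  using additive_subgroup.a_closed[OF ideal.axioms(1)[OF ideal_clifford_ideal], of f g h] by (simp add: free_alg_simps)

lemma clifford_ideal_diff:
  "f \<in> clifford_ideal g \<Longrightarrow> h \<in> clifford_ideal g \<Longrightarrow> (\<lambda>w. f w - h w) \<in> clifford_ideal g"
  using clifford_ideal_add[of f g "\<lambda>w. -1 * h w"] clifford_ideal_scale[of h g "-1"] by simp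

lemma clifford_ideal_zero: "(\<lambda>w. 0) \<in> clifford_ideal g"
  using additive_subgroup.zero_closed[OF ideal.axioms(1)[OF ideal_clifford_ideal], of g] by (simp add: free_alg_simps)

lemma clifford_ideal_sum:
  "(\<And>i. i \<in> I \<Longrightarrow> f i \<in> clifford_ideal g) \<Longrightarrow> (\<lambda>w. \<Sum>i\<in>I. c i * f i w) \<in> clifford_ideal g"
proof (induction I rule: infinite_finite_induct)
  case (insert i I)
  then show ?case by (simp add: clifford_ideal_add clifford_ideal_scale)
qed (simp_all add: clifford_ideal_zero)

lemma clifford_ideal_conv_left:
  "f \<in> clifford_ideal g \<Longrightarrow> h \<in> carrier free_alg \<Longrightarrow> conv h f \<in> clifford_ideal g"
  using ideal.I_l_closed[OF ideal_clifford_ideal, of f g h] by (simp add: free_alg_simps)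

lemma clifford_ideal_conv_right:
  "f \<in> clifford_ideal g \<Longrightarrow> h \<in> carrier free_alg \<Longrightarrow> conv f h \<in> clifford_ideal g"
  using ideal.I_r_closed[OF ideal_clifford_ideal, of f g h] by (simp add: free_alg_simps)

lemma clifford_ideal_word_sum:
  assumes "finite B"
  shows "(\<lambda>x. word [\<Sum>b\<in>B. \<alpha> b *\<^sub>R b] x - (\<Sum>b\<in>B. complex_of_real (\<alpha> b) * word [b] x))
    \<in> clifford_ideal g"
  using assms
proof (induction B rule: finite_induct)
  case empty
  \<comment> \<open>The scaling relation with both entries 0 puts the letter 0 into the ideal, which
    is what the empty sum needs.\<close>
  have "(\<lambda>x. word [0 *\<^sub>R 0] x - complex_of_real 0 * word [0] x) \<in> clifford_ideal g"
    by (rule clifford_relation_in_ideal) (unfold clifford_relations_def, blast)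
  then show ?case by simp
next
  case (insert b B)
  let ?v = "\<Sum>b\<in>B. \<alpha> b *\<^sub>R b"
  have 1: "(\<lambda>x. word [\<alpha> b *\<^sub>R b + ?v] x - word [\<alpha> b *\<^sub>R b] x - word [?v] x) \<in> clifford_ideal g"
    by (rule clifford_relation_in_ideal) (unfold clifford_relations_def, blast)
  have 2: "(\<lambda>x. word [\<alpha> b *\<^sub>R b] x - complex_of_real (\<alpha> b) * word [b] x) \<in> clifford_ideal g"
    by (rule clifford_relation_in_ideal) (unfold clifford_relations_def, blast)
  have "(\<lambda>x. word [\<alpha> b *\<^sub>R b + ?v] x -
      (complex_of_real (\<alpha> b) * word [b] x + (\<Sum>b\<in>B. complex_of_real (\<alpha> b) * word [b] x)))
      \<in> clifford_ideal g"
    using clifford_ideal_add[OF clifford_ideal_add[OF 1 2] insert.IH] by (simp add: algebra_simps)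
  then show ?case using insert by simp
qed

lemma clifford_ideal_word_sum_pair:
  assumes B: "finite B"
  shows "(\<lambda>x. word [\<Sum>b\<in>B. \<alpha> b *\<^sub>R b, \<Sum>b\<in>B. \<beta> b *\<^sub>R b] x -
      (\<Sum>b\<in>B. \<Sum>d\<in>B. complex_of_real (\<alpha> b * \<beta> d) * word [b, d] x)) \<in> clifford_ideal g"
proof -
  let ?v = "\<Sum>b\<in>B. \<alpha> b *\<^sub>R b" and ?w = "\<Sum>b\<in>B. \<beta> b *\<^sub>R b"
  let ?V = "\<lambda>x. \<Sum>b\<in>B. complex_of_real (\<alpha> b) * word [b] x"
  let ?W = "\<lambda>x. \<Sum>b\<in>B. complex_of_real (\<beta> b) * word [b] x"
  have conv_diff_left: "conv (\<lambda>x. p x - q x) h = (\<lambda>x. conv p h x - conv q h x)"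
    and conv_diff_right: "conv h (\<lambda>x. p x - q x) = (\<lambda>x. conv h p x - conv h q x)" for p q h :: "'a list \<Rightarrow> complex"
    by (simp_all add: fun_eq_iff conv_def algebra_simps sum_subtractf)
  have "conv (\<lambda>x. word [?v] x - ?V x) (word [?w]) \<in> clifford_ideal g"
    by (intro clifford_ideal_conv_right clifford_ideal_word_sum B free_alg_carrier_word)
  moreover have "conv ?V (\<lambda>x. word [?w] x - ?W x) \<in> clifford_ideal g"
    by (intro clifford_ideal_conv_left clifford_ideal_word_sum B free_alg_carrier_sum free_alg_carrier_word)
  \<comment> \<open>Telescoping: with \<open>V\<close> and \<open>W\<close> the expansions of the
    letters \<open>v\<close> and \<open>w\<close>, the difference \<open>v w - V W\<close> is
    \<open>(v - V) w + V (w - W)\<close>.\<close>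
  ultimately have *: "(\<lambda>x. conv (\<lambda>x. word [?v] x - ?V x) (word [?w]) x +
      conv ?V (\<lambda>x. word [?w] x - ?W x) x) \<in> clifford_ideal g"
    by (rule clifford_ideal_add)
  have "conv ?V ?W = (\<lambda>x. \<Sum>b\<in>B. \<Sum>d\<in>B. complex_of_real (\<alpha> b * \<beta> d) * word [b, d] x)"
    unfolding conv_sum_left conv_sum_right conv_word_word
    by (simp add: fun_eq_iff sum_distrib_left algebra_simps)
  then show ?thesis
    using * unfolding conv_diff_left conv_diff_right conv_word_word by simp
qed

lemma clifford_coset_eqI:
  assumes "f \<in> carrier free_alg" "h \<in> carrier free_alg" "(\<lambda>w. f w - h w) \<in> clifford_ideal g"
  shows "clifford_ideal g +>\<^bsub>free_alg\<^esub> f = clifford_ideal g +>\<^bsub>free_alg\<^esub> h"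
  using assms
  by (intro free_alg.quotient_eq_iff_same_a_r_cos[OF ideal_clifford_ideal, THEN iffD1])
    (simp_all add: free_alg_diff)

lemma ring_hom_Cl: "ring_hom_ring free_alg (Cl g) ((+>\<^bsub>free_alg\<^esub>) (clifford_ideal g))"
  unfolding Cl_def by (rule ideal.rcos_ring_hom_ring[OF ideal_clifford_ideal])

interpretation cl_hom: ring_hom_ring free_alg "Cl g" "(+>\<^bsub>free_alg\<^esub>) (clifford_ideal g)" for g
  by (rule ring_hom_Cl)

lemma cl_finsum:
  assumes "finite I" "\<And>i. i \<in> I \<Longrightarrow> f i \<in> carrier free_alg"
  shows "(\<Oplus>\<^bsub>Cl g\<^esub>i\<in>I. clifford_ideal g +>\<^bsub>free_alg\<^esub> f i) =
    clifford_ideal g +>\<^bsub>free_alg\<^esub> (\<lambda>w. \<Sum>i\<in>I. f i w)"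
  using assms
proof (induction I rule: finite_induct)
  case empty
  then show ?case using cl_hom.hom_zero[of g] by (simp add: free_alg_simps)
next
  case (insert i I)
  have c: "(\<lambda>w. \<Sum>i\<in>I. f i w) \<in> carrier free_alg"
    using free_alg_carrier_sum[of I f "\<lambda>_. 1"] insert by simp
  have "(\<Oplus>\<^bsub>Cl g\<^esub>i\<in>insert i I. clifford_ideal g +>\<^bsub>free_alg\<^esub> f i) =
      (clifford_ideal g +>\<^bsub>free_alg\<^esub> f i) \<oplus>\<^bsub>Cl g\<^esub>
      (\<Oplus>\<^bsub>Cl g\<^esub>i\<in>I. clifford_ideal g +>\<^bsub>free_alg\<^esub> f i)"
    using insert by (intro cl_hom.S.finsum_insert) auto
  also have "\<dots> = (clifford_ideal g +>\<^bsub>free_alg\<^esub> f i) \<oplus>\<^bsub>Cl g\<^esub>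
      (clifford_ideal g +>\<^bsub>free_alg\<^esub> (\<lambda>w. \<Sum>i\<in>I. f i w))"
    using insert by simp
  also have "\<dots> = clifford_ideal g +>\<^bsub>free_alg\<^esub> (f i \<oplus>\<^bsub>free_alg\<^esub> (\<lambda>w. \<Sum>i\<in>I. f i w))"
    using insert c by (intro cl_hom.hom_add[symmetric]) auto
  finally show ?case using insert by (simp add: free_alg_simps)
qed

section \<open>Representatives of bivectors and of the section in the free algebra\<close>

definition wedge_rep :: "'v \<Rightarrow> 'v \<Rightarrow> 'v list \<Rightarrow> complex" where
  "wedge_rep v w x = (1/2) * (word [v, w] x - word [w, v] x)"

lemma wedge_rep_eq: "wedge_rep v w = (\<lambda>x. (1/2) * (word [v, w] x - word [w, v] x))"
  by (simp add: fun_eq_iff wedge_rep_def)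

lemma wedge_rep_carrier: "wedge_rep v w \<in> carrier free_alg"
  unfolding wedge_rep_eq
  by (intro free_alg_carrier_scale free_alg_carrier_diff free_alg_carrier_word)

lemma cl_wedge_eq: "cl_wedge g v w = clifford_ideal g +>\<^bsub>free_alg\<^esub> wedge_rep v w"
proof -
  let ?\<pi> = "(+>\<^bsub>free_alg\<^esub>) (clifford_ideal g)"
  have w: "cl_vec g v \<otimes>\<^bsub>Cl g\<^esub> cl_vec g w = ?\<pi> (word [v, w])" for v w
    using cl_hom.hom_mult[OF free_alg_carrier_word free_alg_carrier_word, of g "[v]" "[w]"]
    by (simp add: cl_vec_def free_alg_simps conv_word_word)
  have d: "?\<pi> (word [v, w]) \<ominus>\<^bsub>Cl g\<^esub> ?\<pi> (word [w, v]) = ?\<pi> (\<lambda>x. word [v, w] x - word [w, v] x)"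
  proof -
    have "?\<pi> (word [v, w]) \<ominus>\<^bsub>Cl g\<^esub> ?\<pi> (word [w, v]) = ?\<pi> (word [v, w] \<ominus>\<^bsub>free_alg\<^esub> word [w, v])"
      by (simp add: a_minus_def free_alg_carrier_word)
    then show ?thesis by (simp add: free_alg_diff free_alg_carrier_word)
  qed
  have "cl_wedge g v w = ?\<pi> ((\<lambda>x. (1/2) * word [] x) \<otimes>\<^bsub>free_alg\<^esub> (\<lambda>x. word [v, w] x - word [w, v] x))"
    unfolding cl_wedge_def w d cl_scal_def
    by (intro cl_hom.hom_mult[symmetric] free_alg_carrier_scale free_alg_carrier_diff free_alg_carrier_word)
  also have "(\<lambda>x. (1/2) * word [] x) \<otimes>\<^bsub>free_alg\<^esub> (\<lambda>x. word [v, w] x - word [w, v] x) = wedge_rep v w"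
    unfolding free_alg_simps fun_eq_iff conv_scale_left conv_word_Nil_left wedge_rep_def by simp
  finally show ?thesis .
qed

lemma cl_scal_mult:
  assumes "f \<in> carrier free_alg"
  shows "cl_scal g c \<otimes>\<^bsub>Cl g\<^esub> (clifford_ideal g +>\<^bsub>free_alg\<^esub> f) =
    clifford_ideal g +>\<^bsub>free_alg\<^esub> (\<lambda>x. c * f x)"
proof -
  have "cl_scal g c \<otimes>\<^bsub>Cl g\<^esub> (clifford_ideal g +>\<^bsub>free_alg\<^esub> f) =
      clifford_ideal g +>\<^bsub>free_alg\<^esub> ((\<lambda>x. c * word [] x) \<otimes>\<^bsub>free_alg\<^esub> f)"
    unfolding cl_scal_def
    by (intro cl_hom.hom_mult[symmetric] free_alg_carrier_scale free_alg_carrier_word assms)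
  also have "(\<lambda>x. c * word [] x) \<otimes>\<^bsub>free_alg\<^esub> f = (\<lambda>x. c * f x)"
    by (simp add: fun_eq_iff free_alg_simps conv_scale_left conv_word_Nil_left)
  finally show ?thesis .
qed

definition bivector_rep :: "nat \<Rightarrow> ('v \<Rightarrow> 'v) \<Rightarrow> (nat \<Rightarrow> 'v) \<Rightarrow> (nat \<Rightarrow> real) \<Rightarrow> 'v list \<Rightarrow> complex" where
  "bivector_rep n J e l x = (\<Sum>k<n. complex_of_real (l k) * wedge_rep (e k) (J (e k)) x)"

lemma bivector_rep_eq:
  "bivector_rep n J e l = (\<lambda>x. \<Sum>k<n. complex_of_real (l k) * wedge_rep (e k) (J (e k)) x)"
  by (simp add: fun_eq_iff bivector_rep_def)

lemma bivector_rep_carrier: "bivector_rep n J e l \<in> carrier free_alg"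
  unfolding bivector_rep_eq by (intro free_alg_carrier_sum wedge_rep_carrier)

lemma bivector_coset:
  "(\<Oplus>\<^bsub>Cl g\<^esub>k\<in>{..<n}. cl_scal g (complex_of_real (l k)) \<otimes>\<^bsub>Cl g\<^esub> cl_wedge g (e k) (J (e k))) =
   clifford_ideal g +>\<^bsub>free_alg\<^esub> bivector_rep n J e l"
proof -
  let ?f = "\<lambda>k x. complex_of_real (l k) * wedge_rep (e k) (J (e k)) x"
  have c: "?f k \<in> carrier free_alg" for k
    by (intro free_alg_carrier_scale wedge_rep_carrier)
  have "(\<Oplus>\<^bsub>Cl g\<^esub>k\<in>{..<n}. cl_scal g (complex_of_real (l k)) \<otimes>\<^bsub>Cl g\<^esub> cl_wedge g (e k) (J (e k))) =
      (\<Oplus>\<^bsub>Cl g\<^esub>k\<in>{..<n}. clifford_ideal g +>\<^bsub>free_alg\<^esub> ?f k)"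
    unfolding cl_wedge_eq by (simp add: cl_scal_mult wedge_rep_carrier)
  also have "\<dots> = clifford_ideal g +>\<^bsub>free_alg\<^esub> (\<lambda>w. \<Sum>k<n. ?f k w)"
    by (rule cl_finsum) (simp_all add: c)
  finally show ?thesis unfolding bivector_rep_eq .
qed

definition section_rep ::
  "nat \<Rightarrow> ('v \<Rightarrow> 'v) \<Rightarrow> (nat \<Rightarrow> 'v) \<Rightarrow> (nat \<Rightarrow> real) \<Rightarrow> real \<Rightarrow> 'v list \<Rightarrow> complex" where
  "section_rep n J e l \<mu> x = complex_of_real \<mu> * word [] x + \<i> * bivector_rep n J e l x"

lemma section_rep_eq:
  "section_rep n J e l \<mu> = (\<lambda>x. complex_of_real \<mu> * word [] x + \<i> * bivector_rep n J e l x)"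
  by (simp add: fun_eq_iff section_rep_def)

lemma section_rep_carrier: "section_rep n J e l \<mu> \<in> carrier free_alg"
  unfolding section_rep_eq
  by (intro free_alg_carrier_add free_alg_carrier_scale free_alg_carrier_word bivector_rep_carrier)

lemma section_coset:
  "cl_scal g (complex_of_real \<mu>) \<oplus>\<^bsub>Cl g\<^esub>
     (cl_scal g \<i> \<otimes>\<^bsub>Cl g\<^esub> (clifford_ideal g +>\<^bsub>free_alg\<^esub> bivector_rep n J e l)) =
   clifford_ideal g +>\<^bsub>free_alg\<^esub> section_rep n J e l \<mu>"
proof -
  have "cl_scal g (complex_of_real \<mu>) \<oplus>\<^bsub>Cl g\<^esub>
      (clifford_ideal g +>\<^bsub>free_alg\<^esub> (\<lambda>x. \<i> * bivector_rep n J e l x)) =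
      clifford_ideal g +>\<^bsub>free_alg\<^esub> ((\<lambda>x. complex_of_real \<mu> * word [] x) \<oplus>\<^bsub>free_alg\<^esub>
        (\<lambda>x. \<i> * bivector_rep n J e l x))"
    unfolding cl_scal_def
    by (intro cl_hom.hom_add[symmetric] free_alg_carrier_scale free_alg_carrier_word bivector_rep_carrier)
  then show ?thesis
    unfolding cl_scal_mult[OF bivector_rep_carrier] section_rep_eq free_alg_simps(5) .
qed

section \<open>Clifford action and frame independence\<close>

lemma free_act_superset:
  assumes "finite W" "{w. f w \<noteq> 0} \<subseteq> W"
  shows "free_act g J f s = (\<lambda>x. \<Sum>w\<in>W. f w * foldr (vec_act g J) w s x)"
  unfolding free_act_def fun_eq_iff
  using assms by (auto intro!: sum.mono_neutral_left)

lemma free_act_add: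
  assumes "f \<in> carrier free_alg" "h \<in> carrier free_alg"
  shows "free_act g J (\<lambda>w. f w + h w) s = (\<lambda>x. free_act g J f s x + free_act g J h s x)"
proof -
  let ?W = "{w. f w \<noteq> 0} \<union> {w. h w \<noteq> 0}"
  have W: "finite ?W" using assms by (simp add: free_alg_simps)
  have "{w. f w + h w \<noteq> 0} \<subseteq> ?W" "{w. f w \<noteq> 0} \<subseteq> ?W" "{w. h w \<noteq> 0} \<subseteq> ?W" by auto
  note this[THEN free_act_superset[OF W]]
  then show ?thesis
    by (simp add: distrib_right sum.distrib)
qed

lemma free_act_scale: "free_act g J (\<lambda>w. c * f w) s = (\<lambda>x. c * free_act g J f s x)"
proof (cases "c = 0")
  case False
  then show ?thesis
    by (simp add: free_act_def fun_eq_iff sum_distrib_left mult.assoc)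
qed (simp add: free_act_def fun_eq_iff)

lemma free_act_diff:
  assumes "f \<in> carrier free_alg" "h \<in> carrier free_alg"
  shows "free_act g J (\<lambda>w. f w - h w) s = (\<lambda>x. free_act g J f s x - free_act g J h s x)"
  using free_act_add[OF assms(1) free_alg_carrier_scale[OF assms(2), of "-1"], of g J s]
  unfolding free_act_scale by simp

lemma free_act_sum:
  assumes "\<And>i. i \<in> I \<Longrightarrow> f i \<in> carrier free_alg"
  shows "free_act g J (\<lambda>w. \<Sum>i\<in>I. c i * f i w) s = (\<lambda>x. \<Sum>i\<in>I. c i * free_act g J (f i) s x)"
  using assms
proof (induction I rule: infinite_finite_induct)
  case (insert i I)
  then show ?case
    by (simp add: free_act_add free_act_scale free_alg_carrier_scale free_alg_carrier_sum)
qed (simp_all add: free_act_def fun_eq_iff)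

lemma free_act_word: "free_act g J (word u) s = foldr (vec_act g J) u s"
  by (simp add: free_act_def fun_eq_iff word_def)

lemma vec_act_sum:
  "vec_act g J v (\<lambda>x. \<Sum>i\<in>I. c i * s i x) = (\<lambda>x. \<Sum>i\<in>I. c i * vec_act g J v (s i) x)"
  by (simp add: fun_eq_iff vec_act_def ext_mult_sum contraction_def sum_subtractf algebra_simps)

lemma foldr_vec_act_sum:
  "foldr (vec_act g J) u (\<lambda>x. \<Sum>i\<in>I. c i * s i x) = (\<lambda>x. \<Sum>i\<in>I. c i * foldr (vec_act g J) u (s i) x)"
  by (induction u) (simp_all add: vec_act_sum)

text \<open>Multiplicativity of the action, which is what makes its kernel a two-sided
  ideal.\<close>

lemma free_act_conv:
  assumes f: "f \<in> carrier free_alg" and h: "h \<in> carrier free_alg"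
  shows "free_act g J (conv f h) s = free_act g J f (free_act g J h s)"
proof
  fix x
  let ?F = "{w. f w \<noteq> 0}" and ?H = "{w. h w \<noteq> 0}" and ?act = "foldr (vec_act g J)"
  let ?W = "(\<lambda>(u, v). u @ v) ` (?F \<times> ?H)"
  let ?t = "\<lambda>(w, k). f (take k w) * h (drop k w) * ?act w s x"
  \<comment> \<open>The inverse of cutting a word at a position. Cuts outside the image of
    \<open>?j\<close> have a half outside the support of \<open>f\<close> or \<open>h\<close> and
    contribute nothing.\<close>
  let ?j = "\<lambda>(u, v). (u @ v, length u)"
  have fin: "finite ?F" "finite ?H" "finite ?W" using f h by (auto simp: free_alg_simps)
  have inj: "inj_on ?j (?F \<times> ?H)" by (auto simp: inj_on_def)
  have "free_act g J (conv f h) s x = (\<Sum>w\<in>?W. \<Sum>k\<le>length w. ?t (w, k))"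
    by (simp add: free_act_superset[OF fin(3) conv_support] conv_def sum_distrib_right)
  also have "\<dots> = (\<Sum>p\<in>(SIGMA w:?W. {..length w}). ?t p)"
    using fin by (subst sum.Sigma) auto
  also have "\<dots> = (\<Sum>p\<in>?j ` (?F \<times> ?H). ?t p)"
  proof (rule sum.mono_neutral_right)
    show "\<forall>p\<in>(SIGMA w:?W. {..length w}) - ?j ` (?F \<times> ?H). ?t p = 0"
    proof
      fix p assume p: "p \<in> (SIGMA w:?W. {..length w}) - ?j ` (?F \<times> ?H)"
      obtain w k where wk: "p = (w, k)" by (cases p)
      have "(take k w, drop k w) \<notin> ?F \<times> ?H"
      proof
        assume "(take k w, drop k w) \<in> ?F \<times> ?H"
        then have "?j (take k w, drop k w) \<in> ?j ` (?F \<times> ?H)" by (rule imageI)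
        then show False using p by (simp add: wk)
      qed
      then show "?t p = 0" by (auto simp: wk)
    qed
    show "finite (SIGMA w:?W. {..length w})" using fin by (intro finite_SigmaI) auto
    show "?j ` (?F \<times> ?H) \<subseteq> (SIGMA w:?W. {..length w})" by auto
  qed
  also have "\<dots> = (\<Sum>(u, v)\<in>?F \<times> ?H. f u * (h v * ?act u (?act v s) x))"
    unfolding sum.reindex[OF inj]
    by (intro sum.cong refl) (simp add: split_beta mult.assoc)
  also have "\<dots> = (\<Sum>u\<in>?F. f u * (\<Sum>v\<in>?H. h v * ?act u (?act v s) x))"
    by (simp add: sum.cartesian_product[symmetric] sum_distrib_left)
  also have "\<dots> = free_act g J f (free_act g J h s) x"
    unfolding free_act_superset[OF fin(1) order_refl] free_act_superset[OF fin(2) order_refl]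
      foldr_vec_act_sum ..
  finally show "free_act g J (conv f h) s x = free_act g J f (free_act g J h s) x" .
qed

section \<open>Descent of the action to the Clifford algebra\<close>

context hermitian_space
begin

lemma foldr_vec_act_antiforms: "s \<in> antiforms J \<Longrightarrow> foldr (vec_act g J) u s \<in> antiforms J"
  by (induction u) (simp_all add: vec_act_antiforms)

lemma free_act_antiforms:
  assumes "s \<in> antiforms J"
  shows "free_act g J f s \<in> antiforms J"
proof -
  have "free_act g J f s = (\<lambda>x. \<Sum>w\<in>{w. f w \<noteq> 0}. f w * foldr (vec_act g J) w s x)"
    by (simp add: free_act_def fun_eq_iff)
  then show ?thesis using assms by (simp add: antiforms_sum foldr_vec_act_antiforms)
qed

text \<open>The annihilator is taken on antiforms because the proofs of the relations use their
  properties: linearity in the vector and vanishing of repeated contractions.\<close>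

definition action_kernel :: "('e list \<Rightarrow> complex) set" where
  "action_kernel = {f \<in> carrier free_alg. \<forall>s\<in>antiforms J. free_act g J f s = (\<lambda>x. 0)}"

lemma free_act_zero: "free_act g J f (\<lambda>x. 0) = (\<lambda>x. 0)"
proof -
  have "foldr (vec_act g J) u (\<lambda>x. 0) = (\<lambda>x. 0)" for u
    using foldr_vec_act_sum[where I = "{}"] by simp
  then show ?thesis by (simp add: free_act_def fun_eq_iff)
qed

lemma ideal_action_kernel: "ideal action_kernel free_alg"
proof (rule idealI[OF ring_free_alg])
  show "subgroup action_kernel (add_monoid free_alg)"
  proof (rule free_alg.add.subgroupI)
    show "action_kernel \<subseteq> carrier free_alg" by (auto simp: action_kernel_def)
    have "(\<lambda>w. 0) \<in> action_kernel"
      by (simp add: action_kernel_def free_alg_simps free_act_def fun_eq_iff)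
    then show "action_kernel \<noteq> {}" by blast
    show "\<ominus>\<^bsub>free_alg\<^esub> f \<in> action_kernel" if "f \<in> action_kernel" for f
      using that free_alg_carrier_scale[of f "-1"] free_act_scale[of g J "-1" f]
      by (simp add: action_kernel_def free_alg_neg)
    show "f \<oplus>\<^bsub>free_alg\<^esub> h \<in> action_kernel" if "f \<in> action_kernel" "h \<in> action_kernel" for f h
      using that free_alg_carrier_add[of f h] free_act_add[of f h g J]
      by (simp add: action_kernel_def free_alg_simps(5))
  qed
next
  \<comment> \<open>On the left, \<open>h\<close> is applied to the zero form; on the right,
    \<open>f\<close> is applied to the image of a form under \<open>h\<close>, which is again an
    antiform.\<close>
  fix f h assume "f \<in> action_kernel" "h \<in> carrier (free_alg :: ('e list \<Rightarrow> complex) ring)"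
  then show "h \<otimes>\<^bsub>free_alg\<^esub> f \<in> action_kernel" "f \<otimes>\<^bsub>free_alg\<^esub> h \<in> action_kernel"
    using free_alg.m_closed[of f h] free_alg.m_closed[of h f] free_act_antiforms
    by (simp_all add: action_kernel_def free_alg_simps(2) free_act_conv free_act_zero)
qed

lemma clifford_relations_action: "clifford_relations g \<subseteq> action_kernel"
proof -
  have "(\<lambda>x. word [v + w] x - word [v] x - word [w] x) \<in> action_kernel" for v w
    by (simp add: action_kernel_def free_alg_carrier_diff free_alg_carrier_word free_act_diff
        free_act_word vec_act_plus_vec)
  moreover have "(\<lambda>x. word [a *\<^sub>R v] x - complex_of_real a * word [v] x) \<in> action_kernel" for a v
    by (simp add: action_kernel_def free_alg_carrier_diff free_alg_carrier_scale free_alg_carrier_word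
        free_act_diff free_act_scale free_act_word vec_act_scaleR_vec)
  moreover have "(\<lambda>x. word [v, v] x + complex_of_real (g v v) * word [] x) \<in> action_kernel" for v
    by (simp add: action_kernel_def free_alg_carrier_add free_alg_carrier_scale free_alg_carrier_word
        free_act_add free_act_scale free_act_word vec_act_square)
  ultimately show ?thesis
    unfolding clifford_relations_def by blast
qed

lemma clifford_ideal_action: "clifford_ideal g \<subseteq> action_kernel"
  unfolding clifford_ideal_def
  by (rule free_alg.genideal_minimal[OF ideal_action_kernel clifford_relations_action])

text \<open>Representatives of a class differ by an element of the ideal, which acts by zero; this
  resolves the description in \<open>clifford_act\<close>.\<close>

lemma clifford_act_coset:
  assumes f: "f \<in> carrier free_alg" and s: "s \<in> antiforms J"
  shows "clifford_act g J (clifford_ideal g +>\<^bsub>free_alg\<^esub> f) s = free_act g J f s"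
proof -
  have "free_act g J h s = free_act g J f s" if h: "h \<in> clifford_ideal g +>\<^bsub>free_alg\<^esub> f" for h
  proof -
    obtain i where "i \<in> clifford_ideal g" "h = (\<lambda>w. i w + f w)"
      using h unfolding a_r_coset_def' free_alg_simps by blast
    moreover from this have "i \<in> action_kernel" using clifford_ideal_action by blast
    ultimately show ?thesis
      using f s by (simp add: action_kernel_def free_act_add)
  qed
  moreover have "f \<in> clifford_ideal g +>\<^bsub>free_alg\<^esub> f"
    using f clifford_ideal_zero[of g] by (force simp: a_r_coset_def' free_alg_simps)
  ultimately show ?thesis
    unfolding clifford_act_def by (intro the_equality) blast+
qed

lemma free_act_section:
  assumes s: "s \<in> antiforms J"
  shows "free_act g J (section_rep n J e l \<mu>) s =
    (\<lambda>x. complex_of_real \<mu> * s x + (\<Sum>k<n. complex_of_real (l k) * number_diff (e k) s x))"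
proof -
  have "free_act g J (wedge_rep v (J v)) s = (\<lambda>x. - \<i> * number_diff v s x)" for v
    unfolding wedge_rep_eq free_act_scale
    by (simp add: free_act_diff free_alg_carrier_word free_act_word vec_act_vec_act_J[OF s]
        vec_act_J_vec_act[OF s])
  then have "free_act g J (bivector_rep n J e l) s =
      (\<lambda>x. \<Sum>k<n. complex_of_real (l k) * (- \<i> * number_diff (e k) s x))"
    unfolding bivector_rep_eq by (simp add: free_act_sum wedge_rep_carrier)
  \<comment> \<open>The factor \<open>\<i>\<close> of the section cancels the \<open>- \<i>\<close>
    with which each wedge acts, and the real coefficients \<open>l k\<close> remain.\<close>
  moreover have "\<i> * (\<Sum>k<n. complex_of_real (l k) * (- \<i> * number_diff (e k) s x)) =
      (\<Sum>k<n. complex_of_real (l k) * number_diff (e k) s x)" for x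
  proof -
    have "\<i> * (a * (- \<i> * b)) = (\<i> * - \<i>) * (a * b)" for a b
      by (simp only: mult_ac)
    then show ?thesis by (simp add: sum_distrib_left)
  qed
  ultimately show ?thesis
    unfolding section_rep_eq
    by (simp only: free_act_add free_act_scale free_alg_carrier_scale free_alg_carrier_word
        bivector_rep_carrier free_act_word foldr.simps id_apply)
qed

text \<open>Sending \<open>z\<close> to the vector with coordinates \<open>g z b\<close> is an
  injective linear endomorphism by positivity, hence surjective. The lemma later evaluates the
  descriptions in the canonical bivector, in \<open>christoffel\<close> and in
  \<open>endo_of_form\<close>.\<close>

lemma riesz:
  assumes "linear \<phi>"
  shows "\<exists>!z. \<forall>w. g z w = \<phi> w"
proof -
  let ?T = "\<lambda>z. \<Sum>b\<in>Basis. g z b *\<^sub>R b"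
  have eq: "\<phi>1 = \<phi>2" if "linear \<phi>1" "linear \<phi>2" "\<And>b. b \<in> Basis \<Longrightarrow> \<phi>1 b = \<phi>2 b"
    for \<phi>1 \<phi>2 :: "'e \<Rightarrow> real"
    using that by (rule linear_eq_stdbasis)
  have inner: "?T z \<bullet> b = g z b" if "b \<in> Basis" for z b
    using that by simp
  have "linear ?T"
    by (simp add: linear_iff scaleR_add_left sum.distrib scaleR_sum_right)
  moreover have "inj ?T"
  proof (rule linear_injective_0[OF \<open>linear ?T\<close>, THEN iffD2], intro allI impI)
    fix z assume z: "?T z = 0"
    have "g z = (\<lambda>w. 0)"
    proof (rule eq)
      show "g z b = 0" if "b \<in> Basis" for b
        using inner[OF that, of z] unfolding z by simp
    qed (rule g_linear linear_zero)+
    then have "g z z = 0" by (rule fun_cong)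
    then show "z = 0" using g_pos[of z] by auto
  qed
  ultimately have "surj ?T" by (rule linear_inj_imp_surj)
  from surjD[OF this, of "\<Sum>b\<in>Basis. \<phi> b *\<^sub>R b"]
  obtain z where z: "(\<Sum>b\<in>Basis. \<phi> b *\<^sub>R b) = ?T z" by blast
  have "g z = \<phi>"
  proof (rule eq)
    show "g z b = \<phi> b" if "b \<in> Basis" for b
      using inner[OF that, of z] that unfolding z[symmetric] by simp
  qed (use g_linear assms in auto)
  show ?thesis
  proof (rule ex1I[of _ z])
    show "\<forall>w. g z w = \<phi> w" using \<open>g z = \<phi>\<close> by simp
    fix y assume "\<forall>w. g y w = \<phi> w"
    then have "g (y - z) (y - z) = 0" using \<open>g z = \<phi>\<close> by (simp add: fun_eq_iff)
    then show "y = z" using g_pos[of "y - z"] by auto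
  qed
qed

section \<open>Independence of the bivector from the frame\<close>

lemma frame_expansion:
  assumes "unitary_basis n g J e"
  shows "(\<Sum>k<n. g (e k) v *\<^sub>R e k + g (J (e k)) v *\<^sub>R J (e k)) = v"
proof -
  have on: "g (e j) (e k) = (if j = k then 1 else 0)" "g (e j) (J (e k)) = 0"
    "g (J (e j)) (e k) = 0" if "j < n" "k < n" for j k
    using assms that g_sym[of "J (e j)" "e k"] by (simp_all add: unitary_basis_def)
  have "v \<in> span (e ` {..<n} \<union> (\<lambda>k. J (e k)) ` {..<n})"
    using assms by (simp add: unitary_basis_def)
  then show ?thesis
  proof (induction rule: span_induct_alt)
    case base
    then show ?case by simp
  next
    case (step c v w)
    from step(1) have "(\<Sum>k<n. g (e k) v *\<^sub>R e k + g (J (e k)) v *\<^sub>R J (e k)) = v"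
      by (auto simp: on if_distrib[of "\<lambda>a. a *\<^sub>R _"] cong: if_cong)
    then have "c *\<^sub>R (\<Sum>k<n. g (e k) v *\<^sub>R e k + g (J (e k)) v *\<^sub>R J (e k)) = c *\<^sub>R v" by simp
    moreover have "(\<Sum>k<n. g (e k) (c *\<^sub>R v + w) *\<^sub>R e k + g (J (e k)) (c *\<^sub>R v + w) *\<^sub>R J (e k)) =
        c *\<^sub>R (\<Sum>k<n. g (e k) v *\<^sub>R e k + g (J (e k)) v *\<^sub>R J (e k)) +
        (\<Sum>k<n. g (e k) w *\<^sub>R e k + g (J (e k)) w *\<^sub>R J (e k))"
      unfolding scaleR_sum_right sum.distrib[symmetric]
      by (intro sum.cong refl) (simp add: scaleR_add_left scaleR_add_right)
    ultimately show ?case using step(2) by simp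
  qed
qed

text \<open>The bivector contracted with the covector \<open>g v\<close>: on a unitary frame it
  sends \<open>e k\<close> to \<open>l k\<close> times \<open>J (e k)\<close>, and
  \<open>J (e k)\<close> to minus \<open>l k\<close> times \<open>e k\<close>.\<close>

definition frame_endo :: "(nat \<Rightarrow> 'e) \<Rightarrow> (nat \<Rightarrow> real) \<Rightarrow> 'e \<Rightarrow> 'e" where
  "frame_endo e l v = (\<Sum>k<n. l k *\<^sub>R (g (e k) v *\<^sub>R J (e k) - g (J (e k)) v *\<^sub>R e k))"

lemma skew_part_symmetric:
  assumes "\<And>v w. g (A v) w = g v (A w)"
  shows "g (skew_part J A v) w = g v (skew_part J A w)"
  by (simp add: skew_part_def assms g_J_left)

text \<open>By symmetry, a frame vector not orthogonal to \<open>w\<close> has eigenvalue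
  \<open>c\<close>, so its \<open>l k\<close> equals \<open>\<bar>c\<bar>\<close>. Thus
  \<open>\<bar>c\<bar>\<close> may replace \<open>l k\<close> in every term, and the expansion of
  \<open>w\<close> in the frame is summed up again.\<close>

lemma frame_endo_eigenvector:
  assumes sym: "\<And>v w. g (A v) w = g v (A w)" and e: "skew_frame n g J A e l"
    and w: "skew_part J A w = c *\<^sub>R w"
  shows "frame_endo e l w = \<bar>c\<bar> *\<^sub>R J w"
proof -
  let ?S = "skew_part J A"
  have S: "g (?S v) w = g v (?S w)" for v w by (rule skew_part_symmetric[OF sym])
  have *: "l k * a = \<bar>c\<bar> * a" if "0 \<le> l k" "l k * a = c * a \<or> - l k * a = c * a" for k a
  proof (cases "a = 0")
    case False
    then have "l k = c \<or> - l k = c" using that(2) by (metis mult_right_cancel)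
    then show ?thesis using that(1) by auto
  qed simp
  have u: "unitary_basis n g J e" and l: "\<And>k. k < n \<Longrightarrow> 0 \<le> l k"
    and Se: "\<And>k. k < n \<Longrightarrow> ?S (e k) = l k *\<^sub>R e k" "\<And>k. k < n \<Longrightarrow> ?S (J (e k)) = - l k *\<^sub>R J (e k)"
    using e by (auto simp: skew_frame_def)
  have "l k *\<^sub>R (g (e k) w *\<^sub>R J (e k) - g (J (e k)) w *\<^sub>R e k) =
      \<bar>c\<bar> *\<^sub>R J (g (e k) w *\<^sub>R e k + g (J (e k)) w *\<^sub>R J (e k))" if "k < n" for k
  proof -
    have "l k * g (e k) w = \<bar>c\<bar> * g (e k) w"
      using S[of "e k" w] Se[OF that] w by (intro * l that) simp
    moreover have "l k * g (J (e k)) w = \<bar>c\<bar> * g (J (e k)) w"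
      using S[of "J (e k)" w] Se[OF that] w by (intro * l that) simp
    ultimately show ?thesis
      by (auto simp add: algebra_simps)
  qed
  note term_eq = this
  have "frame_endo e l w = \<bar>c\<bar> *\<^sub>R J (\<Sum>k<n. g (e k) w *\<^sub>R e k + g (J (e k)) w *\<^sub>R J (e k))"
    unfolding frame_endo_def linear_sum[OF J_linear] scaleR_sum_right
    by (intro sum.cong refl term_eq) simp
  then show ?thesis unfolding frame_expansion[OF u] .
qed

text \<open>The vectors of one frame are eigenvectors of the skew part and span the space, and on
  eigenvectors the value mentions no frame.\<close>

lemma frame_endo_unique:
  assumes sym: "\<And>v w. g (A v) w = g v (A w)"
    and e: "skew_frame n g J A e l" and f: "skew_frame n g J A f m"
  shows "frame_endo e l = frame_endo f m"
proof
  fix v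
  have lin: "linear (frame_endo e l)" for e l
    unfolding frame_endo_def
    by (intro linear_compose_sum ballI) (simp add: linear_iff algebra_simps)
  have v: "v \<in> span (e ` {..<n} \<union> (\<lambda>k. J (e k)) ` {..<n})"
    using e by (simp add: skew_frame_def unitary_basis_def)
  show "frame_endo e l v = frame_endo f m v"
  proof (rule linear_eq_on[OF lin lin v])
    fix w assume "w \<in> e ` {..<n} \<union> (\<lambda>k. J (e k)) ` {..<n}"
    then have "\<exists>c. skew_part J A w = c *\<^sub>R w"
      using e unfolding skew_frame_def by blast
    then obtain c where c: "skew_part J A w = c *\<^sub>R w" by blast
    show "frame_endo e l w = frame_endo f m w"
      by (simp only: frame_endo_eigenvector[OF sym e c] frame_endo_eigenvector[OF sym f c])
  qed
qed

text \<open>The frame enters the words in the fixed basis only through \<open>frame_endo\<close>, so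
  equal endomorphisms give congruent bivectors. The factor 1/2 comes from antisymmetrising the
  wedge.\<close>

lemma bivector_rep_canonical:
  "(\<lambda>x. bivector_rep n J e l x - (\<Sum>b\<in>Basis. \<Sum>d\<in>Basis.
      complex_of_real (1/2 * (frame_endo e l (THE z. \<forall>w. g z w = w \<bullet> b) \<bullet> d)) * word [b, d] x))
    \<in> clifford_ideal g"
proof -
  define R where "R k x = (\<Sum>b\<in>Basis. \<Sum>d\<in>Basis.
      complex_of_real ((e k \<bullet> b) * (J (e k) \<bullet> d) - (J (e k) \<bullet> b) * (e k \<bullet> d)) * word [b, d] x)" for k x
  have 1: "(\<lambda>x. (word [e k, J (e k)] x - word [J (e k), e k] x) - R k x) \<in> clifford_ideal g" for k
  proof -
    have pair: "(\<lambda>x. word [v, w] x - (\<Sum>b\<in>Basis. \<Sum>d\<in>Basis.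
        complex_of_real ((v \<bullet> b) * (w \<bullet> d)) * word [b, d] x)) \<in> clifford_ideal g" for v w
      using clifford_ideal_word_sum_pair[of Basis "\<lambda>b. v \<bullet> b" "\<lambda>b. w \<bullet> b" g]
      by (simp add: euclidean_representation)
    show ?thesis
      using clifford_ideal_diff[OF pair[of "e k" "J (e k)"] pair[of "J (e k)" "e k"]]
      by (simp add: R_def algebra_simps sum_subtractf)
  qed
  have 2: "(\<lambda>x. \<Sum>k<n. complex_of_real (l k / 2) * ((word [e k, J (e k)] x - word [J (e k), e k] x) - R k x))
      \<in> clifford_ideal g"
    by (intro clifford_ideal_sum 1)
  have 3: "(\<Sum>k<n. complex_of_real (l k / 2) * R k x) = (\<Sum>b\<in>Basis. \<Sum>d\<in>Basis.
      complex_of_real (1/2 * (frame_endo e l (THE z. \<forall>w. g z w = w \<bullet> b) \<bullet> d)) * word [b, d] x)" for x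
  proof -
    \<comment> \<open>The description picks the vector that represents the coordinate functional of
      \<open>b\<close> with respect to \<open>g\<close>; pairing it with \<open>e k\<close> under
      \<open>g\<close> returns the coordinate of \<open>e k\<close>.\<close>
    have fe: "1/2 * (frame_endo e l (THE z. \<forall>w. g z w = w \<bullet> b) \<bullet> d) =
        (\<Sum>k<n. l k / 2 * ((e k \<bullet> b) * (J (e k) \<bullet> d) - (J (e k) \<bullet> b) * (e k \<bullet> d)))" for b d
    proof -
      have lin: "linear (\<lambda>w. w \<bullet> b)" by (simp add: linear_iff inner_add_left)
      have "g v (THE z. \<forall>w. g z w = w \<bullet> b) = v \<bullet> b" for v
        unfolding g_sym[of v] by (rule theI'[OF riesz[OF lin], THEN spec])
      then show ?thesis
        by (simp add: frame_endo_def inner_sum_left inner_diff_left sum_distrib_left)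
    qed
    have "(\<Sum>k<n. complex_of_real (l k / 2) * R k x) =
        (\<Sum>k<n. \<Sum>b\<in>Basis. \<Sum>d\<in>Basis. complex_of_real (l k / 2 *
          ((e k \<bullet> b) * (J (e k) \<bullet> d) - (J (e k) \<bullet> b) * (e k \<bullet> d))) * word [b, d] x)"
      by (simp add: R_def sum_distrib_left mult.assoc)
    also have "\<dots> = (\<Sum>b\<in>Basis. \<Sum>k<n. \<Sum>d\<in>Basis. complex_of_real (l k / 2 *
          ((e k \<bullet> b) * (J (e k) \<bullet> d) - (J (e k) \<bullet> b) * (e k \<bullet> d))) * word [b, d] x)"
      by (rule sum.swap)
    also have "\<dots> = (\<Sum>b\<in>Basis. \<Sum>d\<in>Basis. \<Sum>k<n. complex_of_real (l k / 2 *
          ((e k \<bullet> b) * (J (e k) \<bullet> d) - (J (e k) \<bullet> b) * (e k \<bullet> d))) * word [b, d] x)"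
      by (intro sum.cong refl sum.swap)
    finally show ?thesis
      unfolding fe by (simp only: of_real_sum sum_distrib_right)
  qed
  have "bivector_rep n J e l x = (\<Sum>k<n. complex_of_real (l k / 2) * (word [e k, J (e k)] x - word [J (e k), e k] x))" for x
    by (simp add: bivector_rep_def wedge_rep_def)
  then show ?thesis
    using 2 unfolding right_diff_distrib sum_subtractf 3 by simp
qed

lemma H_skew_eq:
  assumes sym: "\<And>v w. g (A v) w = g v (A w)" and e: "skew_frame n g J A e l"
  shows "H_skew n g J A = clifford_ideal g +>\<^bsub>free_alg\<^esub> bivector_rep n J e l"
proof -
  have *: "clifford_ideal g +>\<^bsub>free_alg\<^esub> bivector_rep n J f m =
      clifford_ideal g +>\<^bsub>free_alg\<^esub> bivector_rep n J e l" if f: "skew_frame n g J A f m" for f m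
    using clifford_ideal_diff[OF bivector_rep_canonical[of f m] bivector_rep_canonical[of e l]]
    unfolding frame_endo_unique[OF sym f e]
    by (intro clifford_coset_eqI bivector_rep_carrier) simp
  show ?thesis
    unfolding H_skew_def bivector_coset using e by (intro the_equality) (auto dest: *)
qed

lemma M_Lag_eq_endo_det:
  assumes sym: "\<And>v w. g (A v) w = g v (A w)" and ex: "\<exists>e l. skew_frame n g J A e l"
  shows "complex_of_real (M_Lag n g J A) =
    endo_det (spinors n J) (clifford_act g J
      (cl_scal g (complex_of_real (endo_trace A / 2)) \<oplus>\<^bsub>Cl g\<^esub> (cl_scal g \<i> \<otimes>\<^bsub>Cl g\<^esub> H_skew n g J A)))"
    (is "_ = ?det")
proof -
  let ?P = "\<lambda>l. \<Prod>s\<in>{..<n} \<rightarrow>\<^sub>E {-1, 1}. endo_trace A / 2 + (\<Sum>k<n. s k * l k)"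
  have det: "?det = complex_of_real (?P l)" if e: "skew_frame n g J A e l" for e l
  proof -
    interpret unitary_frame n g J e
      by unfold_locales (use e in \<open>simp add: skew_frame_def\<close>)
    show ?thesis
      unfolding H_skew_eq[OF sym e] section_coset
      by (rule endo_det_spinors) (simp add: clifford_act_coset section_rep_carrier free_act_section)
  qed
  obtain e l where e: "skew_frame n g J A e l" using ex by blast
  have "M_Lag n g J A = ?P l"
    unfolding M_Lag_def
  proof (rule the_equality)
    show "\<exists>e l'. skew_frame n g J A e l' \<and> ?P l = ?P l'" using e by blast
    fix m assume "\<exists>e l. skew_frame n g J A e l \<and> m = ?P l"
    then obtain f l' where f: "skew_frame n g J A f l'" and m: "m = ?P l'" by blast
    \<comment> \<open>The two products are compared through the determinant, in which no frame is
      mentioned.\<close>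
    have "complex_of_real (?P l') = complex_of_real (?P l)"
      by (rule trans[OF det[OF f, symmetric] det[OF e]])
    then show "m = ?P l" unfolding m of_real_eq_iff .
  qed
  then show ?thesis by (simp only: det[OF e])
qed

end

section \<open>Existence of skew frames\<close>

lemma quadratic_nonneg_linear_coeff:
  fixes a b :: real
  assumes "\<And>t. 0 \<le> 2 * t * a + t\<^sup>2 * b"
  shows "a = 0"
proof -
  \<comment> \<open>The hypothesis is used at \<open>t = - s * a\<close>. With \<open>s * b\<close>
    at most 1 the quadratic term cannot outweigh half of the linear one, and the bound becomes minus
    \<open>s * a\<^sup>2\<close>.\<close>
  define s where "s = 1 / (\<bar>b\<bar> + 1)"
  have s: "0 < s" "s * b \<le> 1" by (auto simp: s_def divide_simps)
  have "0 \<le> 2 * (- (s * a)) * a + (- (s * a))\<^sup>2 * b" by (rule assms)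
  also have "\<dots> = (s * a\<^sup>2) * (s * b) - 2 * (s * a\<^sup>2)" by (simp add: power2_eq_square)
  also have "\<dots> \<le> (s * a\<^sup>2) * 1 - 2 * (s * a\<^sup>2)"
    using s by (intro diff_right_mono mult_left_mono) auto
  finally have "s * a\<^sup>2 \<le> 0" by simp
  then show ?thesis using s(1) by (simp add: mult_le_0_iff)
qed

context hermitian_space
begin

lemma continuous_on_form:
  assumes "linear S"
  shows "continuous_on X (\<lambda>w. g (S w) w)"
  using assms g_bilinear
  by (intro bounded_bilinear.continuous_on[of g])
    (auto simp: bilinear_conv_bounded_bilinear linear_continuous_on linear_conv_bounded_linear)

text \<open>A maximiser of the Rayleigh quotient is an eigenvector. The quotient is invariant under
  scaling, so the unit sphere of the ambient norm supplies compactness although the quotient is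
  formed with \<open>g\<close>.\<close>

lemma rayleigh_eigenvector:
  assumes S: "linear S" and sym: "\<And>v w. g (S v) w = g v (S w)"
    and W: "subspace W" "\<And>w. w \<in> W \<Longrightarrow> S w \<in> W" and ne: "\<exists>w\<in>W. w \<noteq> 0"
  shows "\<exists>v\<in>W. \<exists>c. v \<noteq> 0 \<and> S v = c *\<^sub>R v \<and> (\<forall>w\<in>W. g (S w) w \<le> c * g w w)"
proof -
  let ?K = "W \<inter> sphere 0 1"
  let ?f = "\<lambda>w. g (S w) w / g w w"
  have gz: "g w w \<noteq> 0" if "w \<noteq> 0" for w using g_pos[OF that] by simp
  have cpt: "compact ?K"
    using closed_subspace[OF W(1)] by (intro closed_Int_compact) auto
  have "linear (\<lambda>w::'e. w)" by (simp add: linear_iff)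
  then have "continuous_on ?K (\<lambda>w. g w w)" by (rule continuous_on_form)
  moreover have "\<forall>w\<in>?K. g w w \<noteq> 0" by (auto intro!: gz)
  ultimately have cont: "continuous_on ?K ?f"
    by (intro continuous_on_divide continuous_on_form[OF S])
  obtain w0 where "w0 \<in> W" "w0 \<noteq> 0" using ne by blast
  then have "(1 / norm w0) *\<^sub>R w0 \<in> ?K" using subspace_scale[OF W(1)] by simp
  then have "?K \<noteq> {}" by blast
  from continuous_attains_sup[OF cpt this cont]
  obtain v where vK: "v \<in> ?K" and mx: "\<forall>w\<in>?K. ?f w \<le> ?f v"
    by (rule bexE)
  have v: "?f w \<le> ?f v" if "w \<in> ?K" for w by (rule bspec[OF mx that])
  define c where "c = ?f v"
  have v0: "v \<in> W" "v \<noteq> 0" using vK by auto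
  have max: "g (S w) w \<le> c * g w w" if "w \<in> W" for w
  proof (cases "w = 0")
    case True
    then show ?thesis by (simp add: linear_0[OF S])
  next
    case False
    then have "?f ((1 / norm w) *\<^sub>R w) \<le> c"
      unfolding c_def using that subspace_scale[OF W(1)] by (intro v) simp
    also have "?f ((1 / norm w) *\<^sub>R w) = ?f w"
      using False by (simp add: linear_scale[OF S])
    finally show ?thesis using g_pos[OF False] by (simp add: divide_le_eq)
  qed
  \<comment> \<open>The residual serves as the direction of variation: by maximality the first-order
    coefficient vanishes, and for this direction it is \<open>g d d\<close>.\<close>
  define d where "d = c *\<^sub>R v - S v"
  have d: "d \<in> W"
    unfolding d_def using W v0 by (intro subspace_diff subspace_scale) auto
  define b where "b = c * g d d - g (S d) d"
  have vv: "g (S v) v = c * g v v" using gz[OF v0(2)] by (simp add: c_def)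
  have gd: "g d w = c * g v w - g (S v) w" for w by (simp add: d_def)
  have quad: "0 \<le> 2 * t * g d d + t\<^sup>2 * b" for t
  proof -
    have "v + t *\<^sub>R d \<in> W" using W v0 d by (intro subspace_add subspace_scale)
    from max[OF this]
    have "0 \<le> c * g (v + t *\<^sub>R d) (v + t *\<^sub>R d) - g (S (v + t *\<^sub>R d)) (v + t *\<^sub>R d)" by simp
    also have "\<dots> = (c * g v v - g (S v) v) + 2 * t * (c * g v d - g (S v) d) + t\<^sup>2 * b"
      using sym[of d v] g_sym[of d v] g_sym[of d "S v"]
      by (simp add: linear_add[OF S] linear_scale[OF S] b_def power2_eq_square algebra_simps)
    also have "c * g v d - g (S v) d = g d d"
      by (rule gd[symmetric])
    finally show ?thesis using vv by simp
  qed
  have "g d d = 0" by (rule quadratic_nonneg_linear_coeff[OF quad])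
  then have "d = 0" using g_pos[of d] by auto
  then have "S v = c *\<^sub>R v" by (simp add: d_def)
  then show ?thesis
    using v0 max by (intro bexI[of _ v] exI[of _ c] conjI ballI)
qed

text \<open>That the \<open>J (e k)\<close> are orthonormal is automatic, since \<open>J\<close> is an isometry; so are their eigenvalues
  \<open>- l k\<close> when \<open>S\<close> anticommutes with \<open>J\<close>.\<close>

definition partial_frame :: "('e \<Rightarrow> 'e) \<Rightarrow> nat \<Rightarrow> (nat \<Rightarrow> 'e) \<Rightarrow> (nat \<Rightarrow> real) \<Rightarrow> bool" where
  "partial_frame S j e l \<longleftrightarrow>
     (\<forall>i<j. \<forall>k<j. g (e i) (e k) = (if i = k then 1 else 0) \<and> g (e i) (J (e k)) = 0) \<and>
     (\<forall>k<j. 0 \<le> l k \<and> S (e k) = l k *\<^sub>R e k)"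

text \<open>The orthogonal complement \<open>W\<close> of the frame found so far and of its image
  under \<open>J\<close> is stable under \<open>S\<close> and \<open>J\<close>, and it is nonzero
  because \<open>2 * j < 2 * n\<close>.\<close>

lemma partial_frame_extend:
  assumes S: "linear S" and sym: "\<And>v w. g (S v) w = g v (S w)"
    and SJ: "\<And>v. S (J v) = - J (S v)"
    and j: "j < n" and e: "partial_frame S j e l"
  shows "\<exists>e l. partial_frame S (Suc j) e l"
proof -
  define W where "W = {v. \<forall>k<j. g (e k) v = 0 \<and> g (J (e k)) v = 0}"
  have on: "g (e i) (e k) = (if i = k then 1 else 0)" "g (e i) (J (e k)) = 0" "S (e k) = l k *\<^sub>R e k"
    if "i < j" "k < j" for i k
    using e that by (auto simp: partial_frame_def)
  have W: "subspace W" by (auto simp: W_def subspace_def)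
  have WS: "S w \<in> W" if "w \<in> W" for w
    using that by (auto simp: W_def SJ on simp flip: sym)
  have WJ: "J w \<in> W" if "w \<in> W" for w
    using that by (auto simp: W_def g_J_left)
  have "\<exists>w\<in>W. w \<noteq> 0"
  proof -
    let ?E = "e ` {..<j} \<union> (\<lambda>k. J (e k)) ` {..<j}"
    have "card ?E \<le> j + j"
      using card_image_le[of "{..<j}" e] card_image_le[of "{..<j}" "\<lambda>k. J (e k)"]
        card_Un_le[of "e ` {..<j}" "(\<lambda>k. J (e k)) ` {..<j}"] by simp
    then have "dim (span ?E) < DIM('e)"
      using dim_le_card'[of ?E] j DIM_eq by simp
    then have "span ?E \<noteq> UNIV" by (metis dim_UNIV less_irrefl)
    then obtain x where x: "x \<notin> span ?E" by blast
    \<comment> \<open>The orthogonal projection of \<open>x\<close> to the span, so that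
      \<open>x - y\<close> is a nonzero element of \<open>W\<close>.\<close>
    define y where "y = (\<Sum>k<j. g (e k) x *\<^sub>R e k + g (J (e k)) x *\<^sub>R J (e k))"
    have "y \<in> span ?E"
      unfolding y_def by (intro span_sum span_add span_scale span_base) auto
    then have "x - y \<noteq> 0" using x by auto
    moreover have "x - y \<in> W"
    proof -
      have "g (e i) y = g (e i) x" "g (J (e i)) y = g (J (e i)) x" if i: "i < j" for i
        unfolding y_def linear_sum[OF g_linear(1)]
        using i by (simp_all add: on[OF i] g_J_left sum_negf if_distrib[of "\<lambda>a. _ * a"] cong: if_cong)
      then show ?thesis by (simp add: W_def)
    qed
    ultimately show ?thesis by blast
  qed
  then have "\<exists>v\<in>W. \<exists>c. v \<noteq> 0 \<and> S v = c *\<^sub>R v \<and> (\<forall>w\<in>W. g (S w) w \<le> c * g w w)"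
    by (intro rayleigh_eigenvector[OF S sym W] WS)
  then obtain v c where v: "v \<in> W" "v \<noteq> 0" "S v = c *\<^sub>R v" and mx: "\<forall>w\<in>W. g (S w) w \<le> c * g w w"
    by (elim bexE exE conjE)
  \<comment> \<open>\<open>J v\<close> lies in \<open>W\<close> and is an eigenvector for
    \<open>- c\<close>, so maximality of \<open>c\<close> gives \<open>- c \<le> c\<close>.\<close>
  have "c \<ge> 0"
    using bspec[OF mx WJ[OF v(1)]] g_pos[OF v(2)] v(3) by (simp add: SJ zero_le_mult_iff)
  define u where "u = (1 / sqrt (g v v)) *\<^sub>R v"
  have u: "u \<in> W" "S u = c *\<^sub>R u" "g u u = 1"
    using v subspace_scale[OF W] g_pos[OF v(2)]
    by (auto simp: u_def linear_scale[OF S] field_simps)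
  have "partial_frame S (Suc j) (e(j := u)) (l(j := c))"
    unfolding partial_frame_def
  proof (intro conjI allI impI)
    have uW: "g (e k) u = 0" "g u (e k) = 0" "g (e k) (J u) = 0" "g u (J (e k)) = 0" if "k < j" for k
      using u(1) that g_sym[of u "e k"] g_sym[of u "J (e k)"]
      by (simp_all add: W_def g_J_left)
    fix i k assume "i < Suc j" "k < Suc j"
    then show "g ((e(j := u)) i) ((e(j := u)) k) = (if i = k then 1 else 0)"
      "g ((e(j := u)) i) (J ((e(j := u)) k)) = 0"
      using u(3) by (auto simp: less_Suc_eq on uW)
  next
    fix k assume "k < Suc j"
    then show "0 \<le> (l(j := c)) k" "S ((e(j := u)) k) = (l(j := c)) k *\<^sub>R (e(j := u)) k"
      using e u(2) \<open>c \<ge> 0\<close> by (auto simp: less_Suc_eq partial_frame_def)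
  qed
  then show ?thesis by blast
qed

lemma unitary_basis_of_partial_frame:
  assumes "partial_frame S n e l"
  shows "unitary_basis n g J e"
proof -
  have on: "g (e i) (e k) = (if i = k then 1 else 0)" "g (e i) (J (e k)) = 0" "g (J (e i)) (e k) = 0"
    if "i < n" "k < n" for i k
    using assms that by (auto simp: partial_frame_def g_J_left)
  let ?E = "e ` {..<n} \<union> (\<lambda>k. J (e k)) ` {..<n}"
  have orth: "g v w = (if v = w then 1 else 0)" if "v \<in> ?E" "w \<in> ?E" for v w
    using that on by (force split: if_splits)
  have "independent ?E"
  proof
    assume "dependent ?E"
    then obtain v where v: "v \<in> ?E" "v \<in> span (?E - {v})" by (auto simp: dependent_def)
    have "span (?E - {v}) \<subseteq> {w. g v w = 0}"
      using orth[OF v(1)] by (intro span_minimal) (auto simp: subspace_def)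
    then show False using v orth[of v v] by auto
  qed
  moreover have "card ?E = DIM('e)"
  proof -
    have ie: "inj_on e {..<n}" "inj_on (\<lambda>k. J (e k)) {..<n}"
      using on by (auto intro!: inj_onI) (metis zero_neq_one g_J_J)+
    have "e ` {..<n} \<inter> (\<lambda>k. J (e k)) ` {..<n} = {}"
      using on by (auto) (metis zero_neq_one)
    then show ?thesis
      using DIM_eq ie
      by (simp add: card_Un_disjoint card_image)
  qed
  ultimately have "span ?E = UNIV"
    using card_ge_dim_independent[of ?E UNIV] by auto
  then show ?thesis using on by (simp add: unitary_basis_def)
qed

lemma skew_frame_exists:
  assumes A: "linear A" and sym: "\<And>v w. g (A v) w = g v (A w)"
  shows "\<exists>e l. skew_frame n g J A e l"
proof -
  let ?S = "skew_part J A"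
  have S: "linear ?S"
    by (simp add: linear_iff skew_part_def linear_add[OF A] linear_scale[OF A] algebra_simps)
  have SJ: "?S (J v) = - J (?S v)" for v
    by (simp add: skew_part_def linear_neg[OF A] algebra_simps)
  have "\<exists>e l. partial_frame ?S j e l" if "j \<le> n" for j
    using that
  proof (induction j)
    case (Suc j)
    then obtain e l where e: "partial_frame ?S j e l" by auto
    from Suc.prems have "j < n" by simp
    then show ?case
      by (rule partial_frame_extend[OF S skew_part_symmetric[OF sym] SJ _ e])
  next
    case 0
    show ?case unfolding partial_frame_def by simp
  qed
  then obtain e l where e: "partial_frame ?S n e l" by blast
  have "skew_frame n g J A e l"
    using e unitary_basis_of_partial_frame[OF e] by (auto simp: skew_frame_def partial_frame_def SJ)
  then show ?thesis by blast
qed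

end

section \<open>Symmetry of the Hessian\<close>

lemma has_real_derivative_along_line:
  fixes f :: "'e::euclidean_space \<Rightarrow> real"
  assumes "f differentiable (at (a + s *\<^sub>R v))"
  shows "((\<lambda>s. f (a + s *\<^sub>R v)) has_real_derivative frechet_derivative f (at (a + s *\<^sub>R v)) v) (at s)"
proof -
  let ?D = "frechet_derivative f (at (a + s *\<^sub>R v))"
  have D: "(f has_derivative ?D) (at (a + s *\<^sub>R v))"
    using assms by (simp add: frechet_derivative_works)
  have "((\<lambda>s. a + s *\<^sub>R v) has_derivative (\<lambda>t. t *\<^sub>R v)) (at s)"
    by (auto intro!: derivative_eq_intros)
  from has_derivative_compose[OF this D]
  have "((\<lambda>s. f (a + s *\<^sub>R v)) has_derivative (\<lambda>t. ?D (t *\<^sub>R v))) (at s)" .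
  moreover have "(\<lambda>t. ?D (t *\<^sub>R v)) = (*) (?D v)"
    using linear_scale[OF has_derivative_linear[OF D]] by (simp add: fun_eq_iff)
  ultimately show ?thesis by (simp add: has_field_derivative_def)
qed

text \<open>The mean value theorem is applied along \<open>v\<close> and then along
  \<open>w\<close>. The second difference is symmetric in \<open>v\<close> and \<open>w\<close>, so
  the roles can be exchanged; the bound on \<open>h\<close> keeps the parallelogram in
  \<open>U\<close>.\<close>

lemma second_difference_mvt:
  fixes f :: "'e::euclidean_space \<Rightarrow> real"
  assumes r: "\<And>z. dist z y < r \<Longrightarrow> z \<in> U" and h: "0 < h" "h * (norm v + norm w) < r"
    and f: "\<And>z. z \<in> U \<Longrightarrow> f differentiable (at z)"
    and fv: "\<And>z. z \<in> U \<Longrightarrow> (\<lambda>z. frechet_derivative f (at z) v) differentiable (at z)"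
  shows "\<exists>q. dist q y < r \<and> f (y + h *\<^sub>R v + h *\<^sub>R w) - f (y + h *\<^sub>R v) - f (y + h *\<^sub>R w) + f y =
    h\<^sup>2 * frechet_derivative (\<lambda>z. frechet_derivative f (at z) v) (at q) w"
proof -
  have near: "dist (y + s *\<^sub>R v + t *\<^sub>R w) y < r" if "0 \<le> s" "s \<le> h" "0 \<le> t" "t \<le> h" for s t
  proof -
    have "dist (y + s *\<^sub>R v + t *\<^sub>R w) y \<le> s * norm v + t * norm w"
      using norm_triangle_ineq[of "s *\<^sub>R v" "t *\<^sub>R w"] that by (simp add: dist_norm add.assoc)
    also have "\<dots> \<le> h * norm v + h * norm w"
      using that by (intro add_mono mult_right_mono) auto
    finally show ?thesis using h by (simp add: algebra_simps)
  qed
  let ?a = "\<lambda>s. f (y + h *\<^sub>R w + s *\<^sub>R v) - f (y + s *\<^sub>R v)"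
  let ?D = "\<lambda>z. frechet_derivative f (at z) v"
  have "DERIV ?a s :> ?D (y + h *\<^sub>R w + s *\<^sub>R v) - ?D (y + s *\<^sub>R v)" if "0 \<le> s" "s \<le> h" for s
  proof -
    have "y + h *\<^sub>R w + s *\<^sub>R v \<in> U" "y + s *\<^sub>R v \<in> U"
      using r[OF near[of s h]] r[OF near[of s 0]] that h by (simp_all add: algebra_simps)
    then show ?thesis by (intro DERIV_diff has_real_derivative_along_line f)
  qed
  from MVT2[OF h(1) this] obtain \<xi> where \<xi>: "0 < \<xi>" "\<xi> < h"
    "?a h - ?a 0 = (h - 0) * (?D (y + h *\<^sub>R w + \<xi> *\<^sub>R v) - ?D (y + \<xi> *\<^sub>R v))"
    by blast
  let ?z = "y + \<xi> *\<^sub>R v"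
  have "DERIV (\<lambda>t. ?D (?z + t *\<^sub>R w)) t :> frechet_derivative ?D (at (?z + t *\<^sub>R w)) w"
    if "0 \<le> t" "t \<le> h" for t
    using r[OF near[of \<xi> t]] that \<xi> by (intro has_real_derivative_along_line fv) simp
  from MVT2[OF h(1) this] obtain \<eta> where \<eta>: "0 < \<eta>" "\<eta> < h"
    "?D (?z + h *\<^sub>R w) - ?D (?z + 0 *\<^sub>R w) = (h - 0) * frechet_derivative ?D (at (?z + \<eta> *\<^sub>R w)) w"
    by blast
  have c: "y + h *\<^sub>R w + \<xi> *\<^sub>R v = ?z + h *\<^sub>R w" "y + h *\<^sub>R w + h *\<^sub>R v = y + h *\<^sub>R v + h *\<^sub>R w"
    by (simp_all add: algebra_simps)
  have "f (y + h *\<^sub>R v + h *\<^sub>R w) - f (y + h *\<^sub>R v) - f (y + h *\<^sub>R w) + f y =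
      h\<^sup>2 * frechet_derivative ?D (at (?z + \<eta> *\<^sub>R w)) w"
    using \<xi>(3) \<eta>(3) unfolding c by (simp add: power2_eq_square algebra_simps)
  moreover have "dist (?z + \<eta> *\<^sub>R w) y < r"
    using near[of \<xi> \<eta>] \<xi> \<eta> by simp
  ultimately show ?thesis by blast
qed

text \<open>One second difference equals both mixed derivatives at points near \<open>y\<close>, up
  to the same factor, and continuity carries the equality to \<open>y\<close>.\<close>

lemma C2_second_derivative_symmetric:
  fixes f :: "'e::euclidean_space \<Rightarrow> real"
  assumes U: "open U" "y \<in> U" and f: "Ck_on 2 U f"
  shows "frechet_derivative (\<lambda>z. frechet_derivative f (at z) w) (at y) v =
    frechet_derivative (\<lambda>z. frechet_derivative f (at z) v) (at y) w"
proof -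
  let ?F = "\<lambda>v w z. frechet_derivative (\<lambda>z. frechet_derivative f (at z) w) (at z) v"
  have f1: "\<And>z. z \<in> U \<Longrightarrow> f differentiable (at z)"
    and f2: "\<And>w z. z \<in> U \<Longrightarrow> (\<lambda>z. frechet_derivative f (at z) w) differentiable (at z)"
    and f3: "\<And>v w. continuous_on U (?F v w)"
    using f by (auto simp: numeral_2_eq_2)
  have "\<bar>?F v w y - ?F w v y\<bar> \<le> \<epsilon>" if "0 < \<epsilon>" for \<epsilon>
  proof -
    have cont: "\<exists>d>0. \<forall>z. dist z y < d \<longrightarrow> z \<in> U \<and> \<bar>?F v w z - ?F v w y\<bar> < \<epsilon> / 2" for v w
    proof -
      have "continuous (at y) (?F v w)"
        using f3 U by (simp add: continuous_on_eq_continuous_at)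
      then obtain d where "0 < d" "\<And>z. dist z y < d \<Longrightarrow> dist (?F v w z) (?F v w y) < \<epsilon> / 2"
        using \<open>0 < \<epsilon>\<close> unfolding continuous_at_eps_delta by (metis half_gt_zero)
      moreover obtain d' where "0 < d'" "\<And>z. dist z y < d' \<Longrightarrow> z \<in> U"
        using U unfolding open_dist by blast
      ultimately show ?thesis
        by (intro exI[of _ "min d d'"]) (auto simp: dist_real_def)
    qed
    obtain d1 d2 where d: "0 < d1" "0 < d2"
      "\<And>z. dist z y < d1 \<Longrightarrow> z \<in> U \<and> \<bar>?F v w z - ?F v w y\<bar> < \<epsilon> / 2"
      "\<And>z. dist z y < d2 \<Longrightarrow> z \<in> U \<and> \<bar>?F w v z - ?F w v y\<bar> < \<epsilon> / 2"
      using cont[of v w] cont[of w v] by metis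
    define r where "r = min d1 d2"
    \<comment> \<open>The summand 1 keeps \<open>N\<close> positive when \<open>v\<close> and
      \<open>w\<close> vanish; the 2 in \<open>h\<close> makes the bound on the parallelogram
      strict.\<close>
    define N where "N = norm v + norm w + 1"
    define h where "h = r / (2 * N)"
    have r: "0 < r" using d by (simp add: r_def)
    have s: "0 < N" by (simp add: N_def add_nonneg_pos)
    have h0: "0 < h" using r s by (simp add: h_def)
    have "h * (norm v + norm w) \<le> h * N" using h0 by (simp add: N_def)
    also have "\<dots> = r / 2" using s by (simp add: h_def)
    also have "\<dots> < r" using r by simp
    finally have hr: "h * (norm v + norm w) < r" .
    then have hr': "h * (norm w + norm v) < r" by (simp add: add.commute)
    have rU: "z \<in> U" if "dist z y < r" for z using d(3) that by (simp add: r_def)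
    obtain q1 where q1: "dist q1 y < r"
      "f (y + h *\<^sub>R w + h *\<^sub>R v) - f (y + h *\<^sub>R w) - f (y + h *\<^sub>R v) + f y = h\<^sup>2 * ?F v w q1"
      using second_difference_mvt[OF rU h0 hr' f1 f2] by blast
    obtain q2 where q2: "dist q2 y < r"
      "f (y + h *\<^sub>R v + h *\<^sub>R w) - f (y + h *\<^sub>R v) - f (y + h *\<^sub>R w) + f y = h\<^sup>2 * ?F w v q2"
      using second_difference_mvt[OF rU h0 hr f1 f2] by blast
    have "y + h *\<^sub>R w + h *\<^sub>R v = y + h *\<^sub>R v + h *\<^sub>R w" by simp
    then have "h\<^sup>2 * ?F v w q1 = h\<^sup>2 * ?F w v q2"
      using q1(2) q2(2) by (simp only:)
    then have "?F v w q1 = ?F w v q2" using h0 by simp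
    moreover have "\<bar>?F v w q1 - ?F v w y\<bar> < \<epsilon> / 2" "\<bar>?F w v q2 - ?F w v y\<bar> < \<epsilon> / 2"
      using d(3)[of q1] d(4)[of q2] q1(1) q2(1) by (auto simp: r_def)
    ultimately show ?thesis by linarith
  qed
  then have "\<bar>?F v w y - ?F w v y\<bar> \<le> 0" by (rule field_le_epsilon[of _ 0, simplified])
  then show ?thesis by simp
qed

lemma smooth_on_differentiable: "smooth_on S f \<Longrightarrow> y \<in> S \<Longrightarrow> f differentiable (at y)"
  unfolding smooth_on_def by (metis Ck_on.simps(2))

section \<open>The metric and the Hessian of a Gromov manifold in a chart\<close>

context gromov_manifold
begin

lemma chart_open: "c \<in> atlas \<Longrightarrow> open (chart_img c)"
  using chart by blast

lemma chart_inv_map: "c \<in> atlas \<Longrightarrow> p \<in> chart_dom c \<Longrightarrow> chart_inv c (chart_map c p) = p"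
  using chart[of c] by (simp add: homeomorphism_def)

lemma chart_inv_in: "c \<in> atlas \<Longrightarrow> y \<in> chart_img c \<Longrightarrow> chart_inv c y \<in> chart_dom c"
  using chart[of c] by (auto simp: homeomorphism_def)

lemma hermitian_tangent_space:
  assumes c: "c \<in> atlas" "p \<in> chart_dom c"
  shows "hermitian_space n (gromov_metric \<omega> J c p) (J c p)"
proof -
  let ?\<omega> = "\<omega> c p" and ?J = "J c p"
  note bl = omega_bilinear[OF c] and Jl = J_linear[OF c]
  have anti: "?\<omega> v w = - ?\<omega> w v" for v w
    using omega_alternating[OF c, of "v + w"] omega_alternating[OF c, of v] omega_alternating[OF c, of w]
    by (simp add: bilinear_ladd[OF bl] bilinear_radd[OF bl] eq_neg_iff_add_eq_0)
  show ?thesis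
  proof (rule hermitian_space.intro)
    show "DIM('e) = 2 * n" by (rule dimension)
    show "bilinear (gromov_metric \<omega> J c p)"
      unfolding bilinear_def gromov_metric_def
      by (simp add: linear_iff bilinear_ladd[OF bl] bilinear_radd[OF bl] bilinear_lmul[OF bl]
          bilinear_rmul[OF bl] linear_add[OF Jl] linear_scale[OF Jl])
    show "gromov_metric \<omega> J c p v w = gromov_metric \<omega> J c p w v" for v w
    proof -
      \<comment> \<open>Invariance moves \<open>J\<close> to the other argument with a sign, and
        antisymmetry of the form removes the sign.\<close>
      have "?\<omega> (?J v) w = ?\<omega> (- v) (?J w)"
        using J_invariant[OF c, of "?J v" w] by (simp add: J_square[OF c])
      also have "\<dots> = ?\<omega> (?J w) v"
        using anti[of v "?J w"] by (simp add: bilinear_lneg[OF bl])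
      finally show ?thesis by (simp add: gromov_metric_def)
    qed
    show "0 < gromov_metric \<omega> J c p v v" if "v \<noteq> 0" for v
      using J_positive[OF c that] by (simp add: gromov_metric_def)
    show "linear ?J" by (rule Jl)
    show "?J (?J v) = - v" for v by (rule J_square[OF c])
    show "gromov_metric \<omega> J c p (?J v) (?J w) = gromov_metric \<omega> J c p v w" for v w
      using J_invariant[OF c, of "?J v" w] by (simp add: gromov_metric_def)
  qed
qed

text \<open>Smoothness of the form is given for constant arguments only, while its first argument
  here is the varying vector \<open>J v\<close>; expanding that vector in the basis reduces to
  products of differentiable functions.\<close>

lemma metric_differentiable:
  assumes c: "c \<in> atlas" and y: "y \<in> chart_img c"
  shows "(\<lambda>y. gromov_metric \<omega> J c (chart_inv c y) v w) differentiable (at y)"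
proof -
  let ?f = "\<lambda>y. \<Sum>b\<in>Basis. (J c (chart_inv c y) v \<bullet> b) * \<omega> c (chart_inv c y) b w"
  have d: "(\<lambda>y. J c (chart_inv c y) v) differentiable (at y)"
    "(\<lambda>y. \<omega> c (chart_inv c y) b w) differentiable (at y)" for b
    using smooth_on_differentiable[OF J_smooth[OF c] y] smooth_on_differentiable[OF omega_smooth[OF c] y]
    by auto
  have "(\<lambda>y. J c (chart_inv c y) v \<bullet> b) differentiable (at y)" for b
    using d(1) by (intro differentiable_inner) auto
  then have f: "?f differentiable (at y)"
    using d(2) by (intro differentiable_sum ballI differentiable_mult) auto
  have eq: "?f x = gromov_metric \<omega> J c (chart_inv c x) v w" if "x \<in> chart_img c" for x
  proof -
    note bl = omega_bilinear[OF c chart_inv_in[OF c that]]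
    have "linear (\<lambda>u. \<omega> c (chart_inv c x) u w)" using bl by (simp add: bilinear_def)
    from linear_sum[OF this, of "\<lambda>b. (J c (chart_inv c x) v \<bullet> b) *\<^sub>R b" Basis]
    show ?thesis
      by (simp add: gromov_metric_def euclidean_representation bilinear_lmul[OF bl])
  qed
  obtain D where "(?f has_derivative D) (at y)" using f by (auto simp: differentiable_def)
  then have "((\<lambda>y. gromov_metric \<omega> J c (chart_inv c y) v w) has_derivative D) (at y)"
    by (rule has_derivative_transform_within_open[OF _ chart_open[OF c] y]) (rule eq)
  then show ?thesis by (auto simp: differentiable_def)
qed

text \<open>Symmetry combines commuting second derivatives of \<open>u\<close> with the symmetry of
  the Christoffel term, the vanishing of torsion. That term is known only through the Koszul
  formula, so its properties are read off by pairing with every \<open>t\<close>.\<close>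

lemma Hess_linear_symmetric:
  assumes c: "c \<in> atlas" and p: "p \<in> chart_dom c" and u: "Ck_function 2 atlas u"
  shows "linear (Hess \<omega> J u c p)"
    and "gromov_metric \<omega> J c p (Hess \<omega> J u c p v) w = gromov_metric \<omega> J c p v (Hess \<omega> J u c p w)"
proof -
  interpret H: hermitian_space n "gromov_metric \<omega> J c p" "J c p"
    by (rule hermitian_tangent_space[OF c p])
  define G where "G = (\<lambda>y. gromov_metric \<omega> J c (chart_inv c y))"
  define y where "y = chart_map c p"
  define f where "f = u \<circ> chart_inv c"
  let ?U = "chart_img c" and ?g = "gromov_metric \<omega> J c p"
  have U: "open ?U" "y \<in> ?U" using chart_open[OF c] p by (auto simp: y_def chart_img_def)
  have Gy: "G y = ?g" using chart_inv_map[OF c p] by (simp add: G_def y_def)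
  have G_diff: "(\<lambda>x. G x v w) differentiable (at y)" for v w
    using metric_differentiable[OF c U(2)] by (simp add: G_def)
  have herm: "hermitian_space n (G x) (J c (chart_inv c x))" if "x \<in> ?U" for x
    using hermitian_tangent_space[OF c chart_inv_in[OF c that]] by (simp add: G_def)
  define dG where "dG v w = frechet_derivative (\<lambda>x. G x v w) (at y)" for v w
  have dG: "((\<lambda>x. G x v w) has_derivative dG v w) (at y)" for v w
    using G_diff by (simp add: dG_def frechet_derivative_works)
  have dG_lin: "linear (dG v w)" for v w using dG has_derivative_linear by blast
  \<comment> \<open>Identities of the metric hold only on the chart image; it is open, so they pass
    to derivatives at \<open>y\<close>.\<close>
  have dG_eqI: "dG v w = D"
    if "(h has_derivative D) (at y)" "\<And>x. x \<in> ?U \<Longrightarrow> h x = G x v w" for v w h D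
  proof -
    have "((\<lambda>x. G x v w) has_derivative D) (at y)"
      by (rule has_derivative_transform_within_open[OF that(1) U that(2)])
    then show ?thesis by (rule has_derivative_unique[OF dG])
  qed
  have dG_sym: "dG v w = dG w v" for v w
    by (rule dG_eqI[OF dG]) (rule hermitian_space.g_sym[OF herm])
  have dG_add: "dG (v + v') w = (\<lambda>z. dG v w z + dG v' w z)" for v v' w
    by (rule dG_eqI[OF has_derivative_add[OF dG dG]])
      (simp add: bilinear_ladd[OF hermitian_space.g_bilinear[OF herm]])
  have dG_scale: "dG (a *\<^sub>R v) w = (\<lambda>z. a * dG v w z)" for a v w
    by (rule dG_eqI[OF has_derivative_mult_right[OF dG]])
      (simp add: bilinear_lmul[OF hermitian_space.g_bilinear[OF herm]])
  have dG_add_r: "dG w (v + v') = (\<lambda>z. dG w v z + dG w v' z)" for v v' w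
    using dG_add[of v v' w] by (simp add: dG_sym)
  have dG_scale_r: "dG w (a *\<^sub>R v) = (\<lambda>z. a * dG w v z)" for a v w
    using dG_scale[of a v w] by (simp add: dG_sym)
  note dG_simps = dG_add dG_scale dG_add_r dG_scale_r linear_add[OF dG_lin] linear_scale[OF dG_lin]
  define \<Gamma> where "\<Gamma> = christoffel G y"
  let ?K = "\<lambda>v w t. dG w t v + dG v t w - dG v w t"
  have \<Gamma>: "2 * ?g (\<Gamma> v w) t = ?K v w t" for v w t
  proof -
    \<comment> \<open>Linearity in \<open>t\<close> lets \<open>riesz\<close> supply the vector that
      the Koszul formula describes.\<close>
    have "linear (\<lambda>t. ?K v w t / 2)"
      by (simp add: linear_iff dG_simps algebra_simps add_divide_distrib diff_divide_distrib)
    then have "\<exists>!z. \<forall>t. ?g z t = ?K v w t / 2" by (rule H.riesz)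
    then have "\<exists>!z. \<forall>t. 2 * ?g z t = ?K v w t" by (simp add: field_simps)
    from theI'[OF this] show ?thesis
      by (simp add: \<Gamma>_def christoffel_def Gy dG_def)
  qed
  have g_eqI: "x = z" if "\<And>t. ?g x t = ?g z t" for x z
    using that[of "x - z"] H.g_pos[of "x - z"] by (auto simp del: H.g_simps simp: bilinear_lsub[OF H.g_bilinear])
  have \<Gamma>_sym: "\<Gamma> v w = \<Gamma> w v" for v w
  proof (rule g_eqI)
    show "?g (\<Gamma> v w) t = ?g (\<Gamma> w v) t" for t
      using \<Gamma>[of v w t] \<Gamma>[of w v t] unfolding dG_sym[of w v] by linarith
  qed
  have \<Gamma>_add: "\<Gamma> (v + v') w = \<Gamma> v w + \<Gamma> v' w" for v v' w
  proof (rule g_eqI)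
    show "?g (\<Gamma> (v + v') w) t = ?g (\<Gamma> v w + \<Gamma> v' w) t" for t
      using \<Gamma>[of "v + v'" w t] \<Gamma>[of v w t] \<Gamma>[of v' w t] by (simp add: dG_simps)
  qed
  have \<Gamma>_scale: "\<Gamma> (a *\<^sub>R v) w = a *\<^sub>R \<Gamma> v w" for a v w
  proof (rule g_eqI)
    fix t
    have "2 * ?g (\<Gamma> (a *\<^sub>R v) w) t = a * (2 * ?g (\<Gamma> v w) t)"
      unfolding \<Gamma> by (simp add: dG_simps algebra_simps)
    then show "?g (\<Gamma> (a *\<^sub>R v) w) t = ?g (a *\<^sub>R \<Gamma> v w) t" by simp
  qed
  have f2: "Ck_on 2 ?U f" using u c by (simp add: Ck_function_def f_def)
  then have fd: "\<And>z. z \<in> ?U \<Longrightarrow> f differentiable (at z)"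
    and fd2: "\<And>w. (\<lambda>z. frechet_derivative f (at z) w) differentiable (at y)"
    using U by (auto simp: numeral_2_eq_2)
  define D2 where "D2 v w = frechet_derivative (\<lambda>z. frechet_derivative f (at z) w) (at y) v" for v w
  have D2_sym: "D2 v w = D2 w v" for v w
    unfolding D2_def by (rule C2_second_derivative_symmetric[OF U f2])
  have D2_lin: "linear (\<lambda>v. D2 v w)" for w
    unfolding D2_def using fd2 has_derivative_linear frechet_derivative_works by blast
  have Df_lin: "linear (frechet_derivative f (at y))"
    using fd[OF U(2)] has_derivative_linear frechet_derivative_works by blast
  define B where "B = hess_form G f y"
  have B: "B v w = D2 v w - frechet_derivative f (at y) (\<Gamma> v w)" for v w
  proof -
    have "vf_deriv (\<lambda>_. w) f = (\<lambda>z. frechet_derivative f (at z) w)"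
      by (simp add: vf_deriv_def fun_eq_iff)
    \<comment> \<open>Constant fields have zero derivative, so only the Christoffel part of the
      connection remains.\<close>
    then show ?thesis
      by (simp add: B_def hess_form_def vf_deriv_def levi_civita_def D2_def \<Gamma>_def)
  qed
  have B_sym: "B v w = B w v" for v w
    unfolding B using D2_sym[of v w] \<Gamma>_sym[of v w] by simp
  have B_lin1: "linear (\<lambda>v. B v w)" for w
    unfolding B by (simp add: linear_iff \<Gamma>_add \<Gamma>_scale linear_add[OF D2_lin] linear_scale[OF D2_lin]
        linear_add[OF Df_lin] linear_scale[OF Df_lin] algebra_simps)
  have B_lin2: "linear (\<lambda>w. B v w)" for v
    using B_lin1[of v] by (simp add: B_sym[of _ v])
  let ?A = "Hess \<omega> J u c p"
  have A: "?g (?A v) w = B v w" for v w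
  proof -
    have "?A v = (THE z. \<forall>w. ?g z w = B v w)"
      by (simp add: Hess_def endo_of_form_def B_def G_def f_def y_def)
    then show ?thesis using theI'[OF H.riesz[OF B_lin2[of v]]] by simp
  qed
  show "linear ?A"
  proof (rule linearI)
    show "?A (v + w) = ?A v + ?A w" for v w
      by (rule g_eqI) (simp add: A linear_add[OF B_lin1])
    show "?A (a *\<^sub>R v) = a *\<^sub>R ?A v" for a v
      by (rule g_eqI) (simp add: A linear_scale[OF B_lin1])
  qed
  show "?g (?A v) w = ?g v (?A w)"
    unfolding H.g_sym[of v] A by (rule B_sym)
qed

end

theorem theorem8p1:
  fixes atlas :: "('a::{t2_space,second_countable_topology}, 'e::euclidean_space) chart set"
    and n :: nat
    and \<omega> :: "('a, 'e) chart \<Rightarrow> 'a \<Rightarrow> 'e \<Rightarrow> 'e \<Rightarrow> real"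
    and J :: "('a, 'e) chart \<Rightarrow> 'a \<Rightarrow> 'e \<Rightarrow> 'e"
    and u :: "'a \<Rightarrow> real"
  assumes "gromov_manifold atlas n \<omega> J"
    and "Ck_function 2 atlas u"
  shows "\<forall>c\<in>atlas. \<forall>p\<in>chart_dom c.
    complex_of_real (M_Lag n (gromov_metric \<omega> J c p) (J c p) (Hess \<omega> J u c p)) =
    endo_det (spinors n (J c p))
      (clifford_act (gromov_metric \<omega> J c p) (J c p) (lag_section n \<omega> J u c p))"
proof (intro ballI)
  fix c p assume c: "c \<in> atlas" "p \<in> chart_dom c"
  interpret gromov_manifold atlas n \<omega> J by (rule assms(1))
  interpret H: hermitian_space n "gromov_metric \<omega> J c p" "J c p"
    by (rule hermitian_tangent_space[OF c])
  note Hess = Hess_linear_symmetric[OF c assms(2)]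
  show "complex_of_real (M_Lag n (gromov_metric \<omega> J c p) (J c p) (Hess \<omega> J u c p)) =
      endo_det (spinors n (J c p))
        (clifford_act (gromov_metric \<omega> J c p) (J c p) (lag_section n \<omega> J u c p))"
    unfolding lag_section_def Let_def Laplacian_def
    by (rule H.M_Lag_eq_endo_det[OF Hess(2) H.skew_frame_exists[OF Hess]])
qed

end
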